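(* Let $\Bbbk$ be a field and $(A,\Delta)$ a cocommutative $\Bbbk$-algebra with a nilpotent maximal (two-sided) ideal $\mathfrak{m}\ne0$ such that $A=\mathfrak{m}\oplus\Bbbk\cdot1_A$ and $\Delta(\mathfrak{m})\subset\mathfrak{m}\otimes\mathfrak{m}$. Let $V$ be an $A$-module and let $\lambda:A\otimes V\to A$, $\kappa=\kappa_V\oplus\kappa_A:V\wedge V\to V\oplus A$ be $\Bbbk$-linear maps such that $\mathscr{H}_{\lambda,\kappa}$ has the PBW property. Suppose $\operatorname{Prim}(A)=\operatorname{Prim}(A^{op})$. If $\lambda(\mathfrak{m},V)\subset\mathfrak{m}$, then $\mathscr{H}_{\lambda,\kappa}$ has trivial center, i.e. $HH^0(\mathscr{H}_{\lambda,\kappa},\mathscr{H}_{\lambda,\kappa})=\Bbbk$.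
   Context: A cocommutative $\Bbbk$-algebra $(A,\Delta)$ is a unital associative $\Bbbk$-algebra $A$ with a $\Bbbk$-algebra map $\Delta:A\to A\otimes A$ satisfying $\Delta(1)=1\otimes1$, coassociativity, and $\Delta=\Delta^{op}$ (no counit or antipode is assumed). Sweedler notation: $\Delta(a)=\sum a_{(1)}\otimes a_{(2)}$. The action of $a\in A$ on $v\in V$ is written $a(v)$. $\operatorname{Prim}(A)=\{x\in A:\mathfrak{m}x=0\}$ and $\operatorname{Prim}(A^{op})=\{x\in A:x\mathfrak{m}=0\}$. $HH^0(\mathscr H,\mathscr H)$ is the zeroth Hochschild cohomology, i.e. the center of $\mathscr H$. $V\wedge V\subset V\otimes V$ is the span of the $v\wedge v'=v\otimes v'-v'\otimes v$; $\kappa(v,v')=\kappa(v\wedge v')$. $\mathscr{H}_{\lambda,\kappa}$ is the quotient of the tensor algebra $T(V\oplus A)$ by the multiplication in $A$ (with $1_A$ the unit) and by the relations $av-\sum a_{(1)}(v)a_{(2)}=\lambda(a,v)$ and $vv'-v'v=\kappa(v,v')$ for $a\in A$, $v,v'\in V$. It is filtered by $\deg A=0$, $\deg V=1$. $\mathscr{H}_{0,0}=\mathrm{Sym}(V)\rtimes A$ is the smash product: $\mathrm{Sym}(V)\otimes A$ with $(f'\otimes a')(f\otimes a)=\sum f'a'_{(1)}(f)\otimes a'_{(2)}a$ for $f\in\mathrm{Sym}^{\ge1}(V)$ ($A$ acting on $\mathrm{Sym}^n(V)$, $n\ge1$, via iterated coproducts) and $(f'\otimes a')(1\otimes a)=f'\otimes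 a'a$. $\mathscr{H}_{\lambda,\kappa}$ has the PBW property if the natural surjection from $\mathscr{H}_{0,0}$ onto its associated graded algebra is an isomorphism.
   Formalization: The A-module V is assumed to be nonzero; for V = 0 the claim fails, since then the algebra is A itself and the last nonzero power of the nilpotent ideal is central. *)

theory Defs
  imports
    "HOL-Library.Poly_Mapping"
    "HOL-Algebra.QuotRing"
    "HOL-Algebra.Algebraic_Closure_Type"
    "HOL-Analysis.Product_Vector"
begin

text \<open>
  Words form a monoid under concatenation, so finitely supported functions on words over
  \<open>'x\<close> form, with the library's convolution product, the free unital associative algebra
  on the set \<open>'x\<close> with coefficients in \<open>'k\<close>.
\<close>

instantiation list :: (type) monoid_add
begin
definition zero_list_def: "0 = []"
definition plus_list_def: "xs + ys = xs @ ys"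
instance by standard (simp_all add: zero_list_def plus_list_def)
end

type_synonym ('x, 'k) freealg = "'x list \<Rightarrow>\<^sub>0 'k"

definition letter :: "'x \<Rightarrow> ('x, 'k::field) freealg"
  where "letter x = Poly_Mapping.single [x] 1"

definition const :: "'k::field \<Rightarrow> ('x, 'k) freealg"
  where "const c = Poly_Mapping.single [] c"

text \<open>
  The tensor algebra \<open>T(W)\<close> of a vector space \<open>W\<close> (with scalar multiplication \<open>s\<close>) is the
  free algebra on the set \<open>W\<close> modulo the ideal generated by the linearity relations. These
  are homogeneous in word length, and the part of length \<open>n\<close> of the quotient is the
  \<open>n\<close>-fold tensor power of \<open>W\<close>. So \<open>tensor_eq s p q\<close> is equality in \<open>T(W)\<close>, and in
  particular equality in \<open>W \<otimes> W\<close> and \<open>W \<otimes> W \<otimes> W\<close> for combinations of words of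
  length \<open>2\<close> and \<open>3\<close>.
\<close>

definition tensor_relations :: "('k::field \<Rightarrow> 'x::ab_group_add \<Rightarrow> 'x) \<Rightarrow> ('x, 'k) freealg set"
  where "tensor_relations s =
    {letter (x + y) - letter x - letter y | x y. True} \<union>
    {letter (s c x) - const c * letter x | c x. True}"

definition tensor_eq ::
    "('k::field \<Rightarrow> 'x::ab_group_add \<Rightarrow> 'x) \<Rightarrow> ('x, 'k) freealg \<Rightarrow> ('x, 'k) freealg \<Rightarrow> bool"
  where "tensor_eq s p q \<longleftrightarrow>
    p - q \<in> genideal (ring_of_type_algebra :: ('x, 'k) freealg ring) (tensor_relations s)"

text \<open>
  An element of \<open>A \<otimes> A\<close> is presented by a formal linear combination \<open>t\<close> of pairs \<open>(b, c)\<close>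
  standing for \<open>b \<otimes> c\<close>. If \<open>t\<close> presents \<open>\<Delta> a\<close>, then \<open>sweedler t f\<close> is the Sweedler sum of
  the \<open>f a\<^sub>(\<^sub>1\<^sub>) a\<^sub>(\<^sub>2\<^sub>)\<close>.
\<close>

definition sweedler ::
    "('a \<times> 'a \<Rightarrow>\<^sub>0 'k::field) \<Rightarrow> ('a \<Rightarrow> 'a \<Rightarrow> ('x, 'k) freealg) \<Rightarrow> ('x, 'k) freealg"
  where "sweedler t f = (\<Sum>(b, c)\<in>Poly_Mapping.keys t. const (Poly_Mapping.lookup t (b, c)) * f b c)"

definition tens :: "('a \<times> 'a \<Rightarrow>\<^sub>0 'k::field) \<Rightarrow> ('a, 'k) freealg"
  where "tens t = sweedler t (\<lambda>b c. letter b * letter c)"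

text \<open>
  \<open>\<Delta> a\<close> is a formal combination presenting the coproduct of \<open>a\<close>; every requirement on the map
  \<open>\<Delta> : A \<rightarrow> A \<otimes> A\<close>, linearity included, is imposed in \<open>A \<otimes> A\<close> or \<open>A \<otimes> A \<otimes> A\<close> and hence
  does not depend on the presentation.
\<close>

locale cocommutative_algebra = vector_space sA
  for sA :: "'k::field \<Rightarrow> 'a::ring_1 \<Rightarrow> 'a" +
  fixes \<Delta> :: "'a \<Rightarrow> ('a \<times> 'a \<Rightarrow>\<^sub>0 'k)"
  assumes scale_mult_left: "sA c a * b = sA c (a * b)"
    and scale_mult_right: "a * sA c b = sA c (a * b)"
    and coproduct_add: "tensor_eq sA (tens (\<Delta> (a + b))) (tens (\<Delta> a) + tens (\<Delta> b))"
    and coproduct_scale: "tensor_eq sA (tens (\<Delta> (sA c a))) (const c * tens (\<Delta> a))"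
    and coproduct_mult: "tensor_eq sA (tens (\<Delta> (a * b)))
      (sweedler (\<Delta> a) (\<lambda>a1 a2. sweedler (\<Delta> b) (\<lambda>b1 b2. letter (a1 * b1) * letter (a2 * b2))))"
    and coproduct_one: "tensor_eq sA (tens (\<Delta> 1)) (letter 1 * letter 1)"
    and coassociative: "tensor_eq sA
      (sweedler (\<Delta> a) (\<lambda>a1 a2. tens (\<Delta> a1) * letter a2))
      (sweedler (\<Delta> a) (\<lambda>a1 a2. letter a1 * tens (\<Delta> a2)))"
    and cocommutative: "tensor_eq sA (tens (\<Delta> a)) (sweedler (\<Delta> a) (\<lambda>a1 a2. letter a2 * letter a1))"

definition in_tensor_square ::
    "('k::field \<Rightarrow> 'a::ab_group_add \<Rightarrow> 'a) \<Rightarrow> 'a set \<Rightarrow> ('a \<times> 'a \<Rightarrow>\<^sub>0 'k) \<Rightarrow> bool"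
  where "in_tensor_square s U t \<longleftrightarrow>
    (\<exists>u. Poly_Mapping.keys u \<subseteq> U \<times> U \<and> tensor_eq s (tens t) (tens u))"

text \<open>
  Linear maps on \<open>X \<otimes> Y\<close> are given as bilinear maps, and linear maps on \<open>V \<and> V\<close> as bilinear
  maps with \<open>f v v = 0\<close>: the subspace \<open>V \<and> V\<close> of \<open>V \<otimes> V\<close> is the image of \<open>t \<mapsto> t - flip t\<close>,
  whose kernel, the symmetric tensors, is spanned in every characteristic by the
  \<open>v \<otimes> v\<close> and \<open>v \<otimes> w + w \<otimes> v\<close>.
\<close>

definition bilinear_map ::
    "('k::field \<Rightarrow> 'x::ab_group_add \<Rightarrow> 'x) \<Rightarrow> ('k \<Rightarrow> 'y::ab_group_add \<Rightarrow> 'y) \<Rightarrow>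
     ('k \<Rightarrow> 'z::ab_group_add \<Rightarrow> 'z) \<Rightarrow> ('x \<Rightarrow> 'y \<Rightarrow> 'z) \<Rightarrow> bool"
  where "bilinear_map s1 s2 s3 f \<longleftrightarrow>
    (\<forall>x. Vector_Spaces.linear s2 s3 (f x)) \<and> (\<forall>y. Vector_Spaces.linear s1 s3 (\<lambda>x. f x y))"

definition algebra_module ::
    "('k::field \<Rightarrow> 'a::ring_1 \<Rightarrow> 'a) \<Rightarrow> ('k \<Rightarrow> 'v::ab_group_add \<Rightarrow> 'v) \<Rightarrow> ('a \<Rightarrow> 'v \<Rightarrow> 'v) \<Rightarrow> bool"
  where "algebra_module sA sV act \<longleftrightarrow> bilinear_map sA sV sV act \<and>
    (\<forall>v. act 1 v = v) \<and> (\<forall>a b v. act (a * b) v = act a (act b v))"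

definition nilpotent_ideal :: "'a::ring_1 set \<Rightarrow> bool"
  where "nilpotent_ideal I \<longleftrightarrow> (\<exists>n. \<forall>xs. length xs = n \<and> set xs \<subseteq> I \<longrightarrow> prod_list xs = 0)"

definition Prim :: "'a::ring_1 set \<Rightarrow> 'a set"
  where "Prim \<mm> = {x. \<forall>y\<in>\<mm>. y * x = 0}"

definition Prim_op :: "'a::ring_1 set \<Rightarrow> 'a set"
  where "Prim_op \<mm> = {x. \<forall>y\<in>\<mm>. x * y = 0}"

text \<open>
  \<open>V \<oplus> A\<close> is the product type, with \<open>(v, 0)\<close> for \<open>v\<close> and \<open>(0, a)\<close> for \<open>a\<close>. Since the tensor
  relations are among the generators of \<open>hideal\<close>, the quotient of the free algebra on
  \<open>V \<oplus> A\<close> by it is the quotient of \<open>T(V \<oplus> A)\<close> by the structure relations \<open>hrelations\<close>.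
\<close>

definition hrelations ::
    "('a::ring_1 \<Rightarrow> ('a \<times> 'a \<Rightarrow>\<^sub>0 'k::field)) \<Rightarrow> ('a \<Rightarrow> 'v::ab_group_add \<Rightarrow> 'v) \<Rightarrow>
     ('a \<Rightarrow> 'v \<Rightarrow> 'a) \<Rightarrow> ('v \<Rightarrow> 'v \<Rightarrow> 'v \<times> 'a) \<Rightarrow> ('v \<times> 'a, 'k) freealg set"
  where "hrelations \<Delta> act lam kap =
    {letter (0, a) * letter (0, b) - letter (0, a * b) | a b. True} \<union>
    {letter (0, 1) - 1} \<union>
    {letter (0, a) * letter (v, 0)
       - sweedler (\<Delta> a) (\<lambda>a1 a2. letter (act a1 v, 0) * letter (0, a2))
       - letter (0, lam a v) | a v. True} \<union>
    {letter (v, 0) * letter (w, 0) - letter (w, 0) * letter (v, 0) - letter (kap v w) | v w. True}"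

definition hideal ::
    "('k::field \<Rightarrow> 'a::ring_1 \<Rightarrow> 'a) \<Rightarrow> ('a \<Rightarrow> ('a \<times> 'a \<Rightarrow>\<^sub>0 'k)) \<Rightarrow>
     ('k \<Rightarrow> 'v::ab_group_add \<Rightarrow> 'v) \<Rightarrow> ('a \<Rightarrow> 'v \<Rightarrow> 'v) \<Rightarrow>
     ('a \<Rightarrow> 'v \<Rightarrow> 'a) \<Rightarrow> ('v \<Rightarrow> 'v \<Rightarrow> 'v \<times> 'a) \<Rightarrow> ('v \<times> 'a, 'k) freealg set"
  where "hideal sA \<Delta> sV act lam kap =
    genideal (ring_of_type_algebra :: ('v \<times> 'a, 'k) freealg ring)
      (tensor_relations (module_prod.scale sV sA) \<union> hrelations \<Delta> act lam kap)"

definition halgebra ::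
    "('k::field \<Rightarrow> 'a::ring_1 \<Rightarrow> 'a) \<Rightarrow> ('a \<Rightarrow> ('a \<times> 'a \<Rightarrow>\<^sub>0 'k)) \<Rightarrow>
     ('k \<Rightarrow> 'v::ab_group_add \<Rightarrow> 'v) \<Rightarrow> ('a \<Rightarrow> 'v \<Rightarrow> 'v) \<Rightarrow>
     ('a \<Rightarrow> 'v \<Rightarrow> 'a) \<Rightarrow> ('v \<Rightarrow> 'v \<Rightarrow> 'v \<times> 'a) \<Rightarrow> ('v \<times> 'a, 'k) freealg set ring"
  where "halgebra sA \<Delta> sV act lam kap = ring_of_type_algebra Quot (hideal sA \<Delta> sV act lam kap)"

definition hclass ::
    "('k::field \<Rightarrow> 'a::ring_1 \<Rightarrow> 'a) \<Rightarrow> ('a \<Rightarrow> ('a \<times> 'a \<Rightarrow>\<^sub>0 'k)) \<Rightarrow>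
     ('k \<Rightarrow> 'v::ab_group_add \<Rightarrow> 'v) \<Rightarrow> ('a \<Rightarrow> 'v \<Rightarrow> 'v) \<Rightarrow>
     ('a \<Rightarrow> 'v \<Rightarrow> 'a) \<Rightarrow> ('v \<Rightarrow> 'v \<Rightarrow> 'v \<times> 'a) \<Rightarrow> ('v \<times> 'a, 'k) freealg \<Rightarrow>
     ('v \<times> 'a, 'k) freealg set"
  where "hclass sA \<Delta> sV act lam kap p =
    hideal sA \<Delta> sV act lam kap +>\<^bsub>ring_of_type_algebra\<^esub> p"

text \<open>
  Filtration by \<open>deg A = 0\<close>, \<open>deg V = 1\<close>: a letter \<open>(v, a) = (v, 0) + (0, a)\<close> has degree \<open>0\<close>
  if \<open>v = 0\<close> and degree at most \<open>1\<close> otherwise.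
\<close>

definition hfilt ::
    "('k::field \<Rightarrow> 'a::ring_1 \<Rightarrow> 'a) \<Rightarrow> ('a \<Rightarrow> ('a \<times> 'a \<Rightarrow>\<^sub>0 'k)) \<Rightarrow>
     ('k \<Rightarrow> 'v::ab_group_add \<Rightarrow> 'v) \<Rightarrow> ('a \<Rightarrow> 'v \<Rightarrow> 'v) \<Rightarrow>
     ('a \<Rightarrow> 'v \<Rightarrow> 'a) \<Rightarrow> ('v \<Rightarrow> 'v \<Rightarrow> 'v \<times> 'a) \<Rightarrow> nat \<Rightarrow> ('v \<times> 'a, 'k) freealg set set"
  where "hfilt sA \<Delta> sV act lam kap n =
    {hclass sA \<Delta> sV act lam kap p | p.
      \<forall>w\<in>Poly_Mapping.keys p. length (filter (\<lambda>x. fst x \<noteq> 0) w) \<le> n}"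

text \<open>
  The associated graded ring of a ring \<open>R\<close> with an ascending filtration \<open>F\<close>: elements of the
  direct sum of the \<open>F n / F (n - 1)\<close>, where \<open>F (- 1) = 0\<close>, as finitely supported sequences of
  cosets. In the product, all choices of representatives \<open>a\<close>, \<open>b\<close> give the same coset.
\<close>

definition filt_pred :: "('r, 'm) ring_scheme \<Rightarrow> (nat \<Rightarrow> 'r set) \<Rightarrow> nat \<Rightarrow> 'r set"
  where "filt_pred R F n = (case n of 0 \<Rightarrow> {\<zero>\<^bsub>R\<^esub>} | Suc m \<Rightarrow> F m)"

definition graded_elem :: "('r, 'm) ring_scheme \<Rightarrow> (nat \<Rightarrow> 'r set) \<Rightarrow> nat \<Rightarrow> 'r \<Rightarrow> nat \<Rightarrow> 'r set"
  where "graded_elem R F n y =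
    (\<lambda>k. if k = n then filt_pred R F n +>\<^bsub>R\<^esub> y else filt_pred R F k)"

definition assoc_graded :: "('r, 'm) ring_scheme \<Rightarrow> (nat \<Rightarrow> 'r set) \<Rightarrow> (nat \<Rightarrow> 'r set) ring"
  where "assoc_graded R F =
    \<lparr>carrier = {x. (\<forall>n. \<exists>y\<in>F n. x n = filt_pred R F n +>\<^bsub>R\<^esub> y) \<and>
                   finite {n. x n \<noteq> filt_pred R F n}},
     monoid.mult = (\<lambda>x y n. \<Union>{filt_pred R F n +>\<^bsub>R\<^esub> (\<Oplus>\<^bsub>R\<^esub>i\<in>{..n}. a i \<otimes>\<^bsub>R\<^esub> b (n - i)) | a b.
                   (\<forall>i\<le>n. a i \<in> x i) \<and> (\<forall>i\<le>n. b i \<in> y i)}),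
     one = graded_elem R F 0 \<one>\<^bsub>R\<^esub>,
     ring.zero = filt_pred R F,
     add = (\<lambda>x y n. x n <+>\<^bsub>R\<^esub> y n)\<rparr>"

text \<open>
  As an algebra, \<open>H\<^sub>0\<^sub>,\<^sub>0\<close> is generated by the images of \<open>V\<close> and \<open>A\<close>, so the natural
  surjection onto the associated graded algebra is the only homomorphism \<open>\<phi>\<close> with the two
  stated values on generators (compatibility with scalars is automatic, as \<open>c\<close> is the image of
  \<open>c 1\<^sub>A\<close>).
\<close>

definition PBW_property ::
    "('k::field \<Rightarrow> 'a::ring_1 \<Rightarrow> 'a) \<Rightarrow> ('a \<Rightarrow> ('a \<times> 'a \<Rightarrow>\<^sub>0 'k)) \<Rightarrow>
     ('k \<Rightarrow> 'v::ab_group_add \<Rightarrow> 'v) \<Rightarrow> ('a \<Rightarrow> 'v \<Rightarrow> 'v) \<Rightarrow>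
     ('a \<Rightarrow> 'v \<Rightarrow> 'a) \<Rightarrow> ('v \<Rightarrow> 'v \<Rightarrow> 'v \<times> 'a) \<Rightarrow> bool"
  where "PBW_property sA \<Delta> sV act lam kap \<longleftrightarrow>
    (let H = halgebra sA \<Delta> sV act lam kap;
         F = hfilt sA \<Delta> sV act lam kap;
         cl = hclass sA \<Delta> sV act lam kap;
         H0 = halgebra sA \<Delta> sV act (\<lambda>_ _. 0) (\<lambda>_ _. 0);
         cl0 = hclass sA \<Delta> sV act (\<lambda>_ _. 0) (\<lambda>_ _. 0)
     in \<exists>\<phi>\<in>ring_iso H0 (assoc_graded H F).
          (\<forall>v. \<phi> (cl0 (letter (v, 0))) = graded_elem H F 1 (cl (letter (v, 0)))) \<and>
          (\<forall>a. \<phi> (cl0 (letter (0, a))) = graded_elem H F 0 (cl (letter (0, a)))))"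

text \<open>The kernel of the Hochschild differential \<open>R \<rightarrow> Hom(R, R)\<close>, i.e. the center.\<close>

definition HH0 :: "('r, 'm) ring_scheme \<Rightarrow> 'r set"
  where "HH0 R = {z \<in> carrier R. \<forall>x\<in>carrier R. z \<otimes>\<^bsub>R\<^esub> x = x \<otimes>\<^bsub>R\<^esub> z}"

end

theory Submission
  imports Defs "HOL-Library.Multiset"
begin

text \<open>
  The center is computed from leading parts. If \<open>z\<close> is central in the deformed algebra, the PBW
  isomorphism turns its part of top degree \<open>n\<close> into a central homogeneous element \<open>p\<close> of the smash
  product \<open>Sym(V) \<rtimes> A\<close>. Such a \<open>p\<close> is a scalar, and it vanishes if \<open>n > 0\<close> (\<open>homog_central\<close>), so
  \<open>z\<close> has lower degree than assumed until degree \<open>0\<close> is reached (\<open>center_eq_scalars\<close>).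

  Nilpotency of the ideal supplies the two elements to test \<open>p\<close> against: a vector \<open>v\<^sub>0 \<noteq> 0\<close>
  killed by the ideal, and a nonzero product \<open>x\<close> of elements of the ideal, as long as possible.
  Since \<open>\<Delta>\<close> maps the ideal into its tensor square, every \<open>a\<close> in the ideal satisfies
  \<open>a v\<^sub>0 = 0\<close> in the smash product. So right multiplication by \<open>v\<^sub>0\<close> keeps only the scalar parts of
  the coefficients of \<open>p \<in> Sym(V) \<otimes> A\<close>, whereas left multiplication by \<open>v\<^sub>0\<close> is injective. Hence
  \<open>p = g \<otimes> 1\<close> with \<open>g \<in> Sym\<^sup>n(V)\<close> (\<open>scalar_coefficients\<close>). If \<open>n > 0\<close>, then \<open>x g = g x\<close> reads
  \<open>\<Sum> x\<^sub>1(g) \<otimes> x\<^sub>2 = g \<otimes> x\<close>. A linear form \<open>\<phi>\<close> on \<open>A\<close> with \<open>\<phi>(x) = 1\<close> gives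
  \<open>g = \<Sum> \<phi>(x\<^sub>2) x\<^sub>1(g)\<close>. The \<open>x\<^sub>1\<close> are combinations of products of the same length as \<open>x\<close>, and one more
  factor from the ideal annihilates them. Therefore \<open>x g = 0\<close>, that is \<open>g \<otimes> x = 0\<close>, and \<open>g = 0\<close>
  (\<open>scalar_commuting_eq_zero\<close>).

  Two foundations carry this argument. First, \<open>\<Delta>\<close> is known only through formal presentations, and
  every identity about Sweedler sums is obtained by evaluating a bilinear or trilinear map on the two
  sides of an equality in a tensor power (\<open>tensor_eq_word_ext\<close>). Second, the quotient of the free
  algebra that defines \<open>Sym(V) \<rtimes> A\<close> has to be shown large enough: it acts on the polynomials with
  coefficients in \<open>A\<close> whose variables are a basis \<open>B\<close> of \<open>V\<close>, and the map sending an element to its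
  action on \<open>1\<close> identifies it with those polynomials (\<open>mem_I0_iff\<close>).
\<close>

section \<open>Ideals and free modules over type-class rings\<close>

lemma type_ring_simps [simp]:
  "carrier ring_of_type_algebra = UNIV"
  "x \<otimes>\<^bsub>ring_of_type_algebra\<^esub> y = x * y"
  "x \<oplus>\<^bsub>ring_of_type_algebra\<^esub> y = x + y"
  "\<one>\<^bsub>ring_of_type_algebra\<^esub> = 1"
  "\<zero>\<^bsub>ring_of_type_algebra\<^esub> = 0"
  by (simp_all add: ring_of_type_algebra_def)

lemma ring_type_ring: "ring (ring_of_type_algebra :: 'r::ring_1 ring)"
proof -
  have "\<exists>y. x + y = 0" for x :: 'r
    using add.right_inverse by blast
  then show ?thesis
    unfolding ring_of_type_algebra_def using add.right_inverse
    by unfold_locales (auto simp: algebra_simps Units_def)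
qed

lemma type_ring_minus [simp]:
  fixes x y :: "'r::ring_1"
  shows "\<ominus>\<^bsub>ring_of_type_algebra\<^esub> x = - x"
    and "x \<ominus>\<^bsub>ring_of_type_algebra\<^esub> y = x - y"
proof -
  interpret ring "ring_of_type_algebra :: 'r ring" by (rule ring_type_ring)
  show *: "\<ominus>\<^bsub>ring_of_type_algebra\<^esub> x = - x" for x :: 'r
    by (rule minus_equality) auto
  show "x \<ominus>\<^bsub>ring_of_type_algebra\<^esub> y = x - y"
    by (simp add: a_minus_def *)
qed

lemma ideal_type_ring_iff:
  fixes I :: "'r::ring_1 set"
  shows "ideal I ring_of_type_algebra \<longleftrightarrow>
    0 \<in> I \<and> (\<forall>x\<in>I. \<forall>y\<in>I. x + y \<in> I) \<and> (\<forall>x\<in>I. \<forall>r. r * x \<in> I \<and> x * r \<in> I)"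
    (is "?L \<longleftrightarrow> ?R")
proof
  assume ?L
  then interpret ideal I "ring_of_type_algebra" .
  show ?R
    using additive_subgroup.zero_closed[OF is_additive_subgroup]
      additive_subgroup.a_closed[OF is_additive_subgroup] I_l_closed I_r_closed
    by auto
next
  assume R: ?R
  have neg: "- x \<in> I" if "x \<in> I" for x
    using R that by (metis mult_minus1)
  show ?L
  proof (rule idealI)
    show "ring (ring_of_type_algebra :: 'r ring)" by (rule ring_type_ring)
    have inv: "inv\<^bsub>add_monoid ring_of_type_algebra\<^esub> x = - x" for x :: 'r
      using type_ring_minus(1)[of x] by (simp add: a_inv_def)
    show "subgroup I (add_monoid ring_of_type_algebra)"
      using R neg by unfold_locales (auto simp: inv[simplified])
  qed (use R in auto)
qed

lemma genideal_type_ring_minimal: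
  fixes S J :: "'r::ring_1 set"
  assumes "p \<in> genideal ring_of_type_algebra S" "S \<subseteq> J"
    and "0 \<in> J" "\<And>x y. x \<in> J \<Longrightarrow> y \<in> J \<Longrightarrow> x + y \<in> J"
    and "\<And>x r. x \<in> J \<Longrightarrow> r * x \<in> J" "\<And>x r. x \<in> J \<Longrightarrow> x * r \<in> J"
  shows "p \<in> J"
proof -
  have "ideal J ring_of_type_algebra"
    using assms by (simp add: ideal_type_ring_iff)
  then show ?thesis
    using assms(1,2) by (auto simp: genideal_def)
qed

text \<open>The common shape of all maps defined on generators of a free module: \<open>f\<close> receives the
  coefficient as an argument, so that it need not be linear over a fixed ring.\<close>

definition coeff_sum :: "('x \<Rightarrow> 'c \<Rightarrow> 'm) \<Rightarrow> ('x \<Rightarrow>\<^sub>0 'c::zero) \<Rightarrow> 'm::comm_monoid_add"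
  where "coeff_sum f p = (\<Sum>k\<in>Poly_Mapping.keys p. f k (Poly_Mapping.lookup p k))"

lemma coeff_sum_superset:
  assumes "finite F" "Poly_Mapping.keys p \<subseteq> F" "\<And>k. f k 0 = 0"
  shows "coeff_sum f p = (\<Sum>k\<in>F. f k (Poly_Mapping.lookup p k))"
  unfolding coeff_sum_def
  by (rule sum.mono_neutral_left) (use assms in \<open>auto simp: in_keys_iff\<close>)

lemma coeff_sum_zero [simp]: "coeff_sum f 0 = 0"
  by (simp add: coeff_sum_def)

lemma coeff_sum_single:
  assumes "f k 0 = 0"
  shows "coeff_sum f (Poly_Mapping.single k c) = f k c"
  using assms by (auto simp: coeff_sum_def)

context
  fixes f :: "'x \<Rightarrow> 'c::ab_group_add \<Rightarrow> 'm::ab_group_add"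
  assumes additive: "\<And>k c d. f k (c + d) = f k c + f k d"
begin

lemma coeff_sum_coeff_zero: "f k 0 = 0"
  using additive[of k 0 0] by simp

lemma coeff_sum_add: "coeff_sum f (p + q) = coeff_sum f p + coeff_sum f q"
proof -
  let ?F = "Poly_Mapping.keys p \<union> Poly_Mapping.keys q"
  have sub: "Poly_Mapping.keys (p + q) \<subseteq> ?F" by (rule keys_add)
  have "coeff_sum f (p + q) = (\<Sum>k\<in>?F. f k (Poly_Mapping.lookup (p + q) k))"
    by (rule coeff_sum_superset) (use sub coeff_sum_coeff_zero in auto)
  also have "\<dots> = (\<Sum>k\<in>?F. f k (Poly_Mapping.lookup p k)) + (\<Sum>k\<in>?F. f k (Poly_Mapping.lookup q k))"
    by (simp add: lookup_add additive sum.distrib)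
  also have "\<dots> = coeff_sum f p + coeff_sum f q"
    by (subst (1 2) coeff_sum_superset[where F = ?F]) (use coeff_sum_coeff_zero in auto)
  finally show ?thesis .
qed

lemma coeff_sum_diff: "coeff_sum f (p - q) = coeff_sum f p - coeff_sum f q"
  using coeff_sum_add[of "p - q" q] by simp

lemma coeff_sum_sum: "coeff_sum f (sum g K) = (\<Sum>x\<in>K. coeff_sum f (g x))"
  by (induction K rule: infinite_finite_induct) (simp_all add: coeff_sum_add)

end

lemma sum_singles: "(\<Sum>k\<in>Poly_Mapping.keys p. Poly_Mapping.single k (Poly_Mapping.lookup p k)) = p"
  by (rule poly_mapping_eqI)
     (simp add: lookup_sum lookup_single when_def in_keys_iff sum.delta')

lemma poly_mapping_additive_induct [case_names single add]:
  fixes p :: "'x \<Rightarrow>\<^sub>0 'c::comm_monoid_add"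
  assumes single: "\<And>k c. P (Poly_Mapping.single k c)"
    and add: "\<And>p q. P p \<Longrightarrow> P q \<Longrightarrow> P (p + q)"
  shows "P p"
proof -
  have zero: "P 0" using single[of undefined 0] by simp
  have "P (\<Sum>k\<in>K. Poly_Mapping.single k (Poly_Mapping.lookup p k))" for K
    by (induction K rule: infinite_finite_induct) (auto intro: zero single add)
  then show ?thesis by (metis sum_singles)
qed

section \<open>Multilinear maps and the tensor algebra\<close>

definition multilinear ::
    "('k::field \<Rightarrow> 'x::ab_group_add \<Rightarrow> 'x) \<Rightarrow> ('k \<Rightarrow> 'm::ab_group_add \<Rightarrow> 'm) \<Rightarrow> ('x list \<Rightarrow> 'm) \<Rightarrow> bool"
  where "multilinear s sM L \<longleftrightarrow>
    (\<forall>us vs x y. L (us @ (x + y) # vs) = L (us @ x # vs) + L (us @ y # vs)) \<and>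
    (\<forall>us vs c x. L (us @ s c x # vs) = sM c (L (us @ x # vs)))"

definition word_ext :: "('k::field \<Rightarrow> 'm::ab_group_add \<Rightarrow> 'm) \<Rightarrow> ('x list \<Rightarrow> 'm) \<Rightarrow> ('x, 'k) freealg \<Rightarrow> 'm"
  where "word_ext sM L = coeff_sum (\<lambda>w c. sM c (L w))"

lemma const_times_single: "const c * Poly_Mapping.single w d = Poly_Mapping.single w (c * d)"
  by (simp add: const_def mult_single plus_list_def)

lemma single_times_const: "Poly_Mapping.single w d * const c = Poly_Mapping.single w (c * d)"
  by (simp add: const_def mult_single plus_list_def mult.commute)

lemma const_central: "const c * p = p * const c"
  by (induction p rule: poly_mapping_additive_induct)
     (simp_all add: const_times_single single_times_const distrib_left distrib_right)

lemma const_one [simp]: "const 1 = 1"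
  by (simp add: const_def zero_list_def[symmetric])

lemma const_simps:
  "const (c + d) = const c + const d" "const (c * d) = const c * const d"
  "const 0 = 0" "const (- c) = - const c" "const (c - d) = const c - const d"
  by (simp_all add: const_def single_add single_uminus single_diff mult_single plus_list_def)

lemma single_Nil_eq_const: "Poly_Mapping.single [] c = const c"
  by (simp add: const_def)

lemma single_Cons_eq_letter:
  "Poly_Mapping.single (x # w) c = letter x * Poly_Mapping.single w c"
  by (simp add: letter_def mult_single plus_list_def)

context vector_space
begin

lemma word_ext_add: "word_ext scale L (p + q) = word_ext scale L p + word_ext scale L q"
  unfolding word_ext_def by (rule coeff_sum_add) (rule scale_left_distrib)

lemma word_ext_diff: "word_ext scale L (p - q) = word_ext scale L p - word_ext scale L q"
  unfolding word_ext_def by (rule coeff_sum_diff) (rule scale_left_distrib)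

lemma word_ext_sum: "word_ext scale L (sum g K) = (\<Sum>x\<in>K. word_ext scale L (g x))"
  unfolding word_ext_def by (rule coeff_sum_sum) (rule scale_left_distrib)

lemma word_ext_single: "word_ext scale L (Poly_Mapping.single w c) = scale c (L w)"
  unfolding word_ext_def by (rule coeff_sum_single) simp

lemma word_ext_const: "word_ext scale L (const c * p) = scale c (word_ext scale L p)"
  by (induction p rule: poly_mapping_additive_induct)
     (simp_all add: const_times_single distrib_left word_ext_add word_ext_single scale_right_distrib)

text \<open>A multilinear map on words descends to the tensor algebra: a linearity relation multiplied by
  words on both sides is an instance of multilinearity in one slot. The relations therefore lie in
  the largest two-sided ideal contained in its kernel.\<close>

lemma tensor_eq_word_ext:
  assumes L: "multilinear s scale L" and "tensor_eq s p q"
  shows "word_ext scale L p = word_ext scale L q"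
proof -
  \<comment> \<open>two-sided multipliers make this an ideal by construction\<close>
  define J where "J = {r. \<forall>f g. word_ext scale L (f * r * g) = 0}"
  have word: "word_ext scale L (Poly_Mapping.single u c * r * Poly_Mapping.single w d) = 0"
    if r: "r \<in> tensor_relations s" for r u c w d
  proof -
    have L1: "L (u @ (x + y) # w) = L (u @ x # w) + L (u @ y # w)"
      and L2: "L (u @ s e x # w) = scale e (L (u @ x # w))" for x y e
      using L by (auto simp: multilinear_def)
    have cx: "Poly_Mapping.single u c * (const e * letter x) = const e * (Poly_Mapping.single u c * letter x)"
      for e x by (metis const_central mult.assoc)
    from r consider x y where "r = letter (x + y) - letter x - letter y"
      | e x where "r = letter (s e x) - const e * letter x"
      by (auto simp: tensor_relations_def)
    then show ?thesis
    proof cases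
      case 1
      then show ?thesis
        by (simp add: letter_def mult_single plus_list_def left_diff_distrib right_diff_distrib
            word_ext_diff word_ext_single L1 scale_right_distrib)
    next
      case 2
      then show ?thesis
        by (simp only: left_diff_distrib right_diff_distrib word_ext_diff cx mult.assoc word_ext_const)
           (simp add: letter_def mult_single plus_list_def word_ext_single L2 scale_left_commute)
    qed
  qed
  have "r \<in> J" if r: "r \<in> tensor_relations s" for r
  proof -
    have "word_ext scale L (f * r * g) = 0" for f g
    proof (induction f rule: poly_mapping_additive_induct)
      case (single u c)
      show ?case
        by (induction g rule: poly_mapping_additive_induct)
           (simp_all add: word[OF r] distrib_left word_ext_add)
    qed (simp add: distrib_right word_ext_add)
    then show ?thesis by (simp add: J_def)
  qed
  moreover have "0 \<in> J" by (simp add: J_def word_ext_def)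
  moreover have "x + y \<in> J" if "x \<in> J" "y \<in> J" for x y
    using that by (simp add: J_def distrib_left distrib_right word_ext_add)
  moreover have "r * x \<in> J" "x * r \<in> J" if x: "x \<in> J" for x r
  proof -
    have "word_ext scale L (f * (r * x) * g) = word_ext scale L ((f * r) * x * g)"
      "word_ext scale L (f * (x * r) * g) = word_ext scale L (f * x * (r * g))" for f g
      by (simp_all add: mult.assoc)
    then show "r * x \<in> J" "x * r \<in> J"
      using x by (simp_all add: J_def)
  qed
  ultimately have "p - q \<in> J"
    using assms(2) genideal_type_ring_minimal[of "p - q" "tensor_relations s" J]
    unfolding tensor_eq_def by blast
  then have "word_ext scale L (1 * (p - q) * 1) = 0"
    unfolding J_def by blast
  then show ?thesis by (simp add: word_ext_diff)
qed

end

section \<open>Sweedler sums\<close>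

lemma mult_const_left_commute: "p * (const c * q) = const c * (p * q)"
  by (metis const_central mult.assoc)

definition bilin ::
    "('k::field \<Rightarrow> 'x::ab_group_add \<Rightarrow> 'x) \<Rightarrow> ('k \<Rightarrow> 'm::ab_group_add \<Rightarrow> 'm) \<Rightarrow> ('x \<Rightarrow> 'x \<Rightarrow> 'm) \<Rightarrow> bool"
  where "bilin s sM \<beta> \<longleftrightarrow>
    (\<forall>a b c. \<beta> (a + b) c = \<beta> a c + \<beta> b c) \<and> (\<forall>a b c. \<beta> a (b + c) = \<beta> a b + \<beta> a c) \<and>
    (\<forall>r a b. \<beta> (s r a) b = sM r (\<beta> a b)) \<and> (\<forall>r a b. \<beta> a (s r b) = sM r (\<beta> a b))"

lemma bilinI:
  assumes "\<And>a b c. \<beta> (a + b) c = \<beta> a c + \<beta> b c" "\<And>a b c. \<beta> a (b + c) = \<beta> a b + \<beta> a c"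
    and "\<And>r a b. \<beta> (s r a) b = sM r (\<beta> a b)" "\<And>r a b. \<beta> a (s r b) = sM r (\<beta> a b)"
  shows "bilin s sM \<beta>"
  using assms by (simp add: bilin_def)

lemma bilinD:
  assumes "bilin s sM \<beta>"
  shows "\<beta> (a + b) c = \<beta> a c + \<beta> b c" "\<beta> a (b + c) = \<beta> a b + \<beta> a c"
    "\<beta> (s r a) b = sM r (\<beta> a b)" "\<beta> a (s r b) = sM r (\<beta> a b)"
  using assms by (simp_all add: bilin_def)

definition word_form2 :: "('x \<Rightarrow> 'x \<Rightarrow> 'm::zero) \<Rightarrow> 'x list \<Rightarrow> 'm"
  where "word_form2 \<beta> w = (if length w = 2 then \<beta> (w ! 0) (w ! 1) else 0)"

definition word_form3 :: "('x \<Rightarrow> 'x \<Rightarrow> 'x \<Rightarrow> 'm::zero) \<Rightarrow> 'x list \<Rightarrow> 'm"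
  where "word_form3 \<gamma> w = (if length w = 3 then \<gamma> (w ! 0) (w ! 1) (w ! 2) else 0)"

text \<open>Sweedler sums with values in a vector space. Each axiom on \<open>\<Delta>\<close> becomes an equation between
  sums once a bilinear or trilinear map is applied to it.\<close>

locale sweedler_calculus = cocommutative_algebra sA \<Delta> + M: vector_space sM
  for sA :: "'k::field \<Rightarrow> 'a::ring_1 \<Rightarrow> 'a"
    and \<Delta> :: "'a \<Rightarrow> ('a \<times> 'a \<Rightarrow>\<^sub>0 'k)"
    and sM :: "'k \<Rightarrow> 'm::ab_group_add \<Rightarrow> 'm"
begin

definition cosum :: "'a \<Rightarrow> ('a \<Rightarrow> 'a \<Rightarrow> 'm) \<Rightarrow> 'm"
  where "cosum a \<beta> = (\<Sum>(b, c)\<in>Poly_Mapping.keys (\<Delta> a). sM (Poly_Mapping.lookup (\<Delta> a) (b, c)) (\<beta> b c))"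

lemma cosum_map:
  assumes add: "\<And>x y. f (x + y) = f x + f y" and scale: "\<And>c x. f (sM c x) = sM c (f x)"
  shows "f (cosum a \<beta>) = cosum a (\<lambda>b c. f (\<beta> b c))"
proof -
  have "f 0 = 0" using add[of 0 0] by simp
  then have "f (sum g K) = (\<Sum>x\<in>K. f (g x))" for g :: "'a \<times> 'a \<Rightarrow> 'm" and K
    by (induction K rule: infinite_finite_induct) (simp_all add: add)
  then show ?thesis
    by (simp add: cosum_def case_prod_beta scale)
qed

lemma cosum_add_fun: "cosum a (\<lambda>b c. \<beta> b c + \<gamma> b c) = cosum a \<beta> + cosum a \<gamma>"
  by (simp add: cosum_def case_prod_beta M.scale_right_distrib sum.distrib)

lemma cosum_scale_fun: "cosum a (\<lambda>b c. sM r (\<beta> b c)) = sM r (cosum a \<beta>)"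
  by (simp add: cosum_map M.scale_right_distrib M.scale_left_commute)

lemma cosum_zero_fun: "cosum a (\<lambda>b c. 0) = 0"
  by (simp add: cosum_def case_prod_beta)

lemma word_ext_sweedler:
  "word_ext sM L (sweedler t f) =
    (\<Sum>(b, c)\<in>Poly_Mapping.keys t. sM (Poly_Mapping.lookup t (b, c)) (word_ext sM L (f b c)))"
  by (simp add: sweedler_def M.word_ext_sum M.word_ext_const case_prod_beta)

lemma word_ext_letters2: "word_ext sM (word_form2 \<beta>) (letter a * letter b) = \<beta> a b"
  by (simp add: letter_def mult_single plus_list_def M.word_ext_single word_form2_def)

lemma word_ext_letters3: "word_ext sM (word_form3 \<gamma>) (letter a * letter b * letter c) = \<gamma> a b c"
  by (simp add: letter_def mult_single plus_list_def M.word_ext_single word_form3_def)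

lemma multilinear_word_form2:
  assumes "bilin sA sM \<beta>"
  shows "multilinear sA sM (word_form2 \<beta>)"
  unfolding multilinear_def
proof (intro conjI allI)
  fix us vs :: "'a list" and x y and c
  note b = bilinD[OF assms]
  consider "length us + length vs \<noteq> 1" | d where "us = []" "vs = [d]" | d where "us = [d]" "vs = []"
    by (cases us; cases vs) (auto simp: length_Suc_conv)
  then show "word_form2 \<beta> (us @ (x + y) # vs) = word_form2 \<beta> (us @ x # vs) + word_form2 \<beta> (us @ y # vs)"
    and "word_form2 \<beta> (us @ sA c x # vs) = sM c (word_form2 \<beta> (us @ x # vs))"
    by (cases; simp add: word_form2_def b)+
qed

lemma multilinear_word_form3:
  assumes "\<And>a. bilin sA sM (\<gamma> a)" "\<And>c. bilin sA sM (\<lambda>a b. \<gamma> a b c)"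
  shows "multilinear sA sM (word_form3 \<gamma>)"
  unfolding multilinear_def
proof (intro conjI allI)
  fix us vs :: "'a list" and x y and c
  note b = bilinD[OF assms(1)] bilinD[OF assms(2)]
  consider "length us + length vs \<noteq> 2" | d e where "us = []" "vs = [d, e]"
    | d e where "us = [d]" "vs = [e]" | d e where "us = [d, e]" "vs = []"
  proof (cases "length us + length vs = 2")
    case True
    then have "length us = 0 \<and> length vs = 2 \<or> length us = 1 \<and> length vs = 1 \<or>
        length us = 2 \<and> length vs = 0"
      by linarith
    then show ?thesis
      using that by (auto simp: length_Suc_conv numeral_2_eq_2)
  qed (use that in blast)
  then show "word_form3 \<gamma> (us @ (x + y) # vs) = word_form3 \<gamma> (us @ x # vs) + word_form3 \<gamma> (us @ y # vs)"
    and "word_form3 \<gamma> (us @ sA c x # vs) = sM c (word_form3 \<gamma> (us @ x # vs))"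
    by (cases; simp add: word_form3_def b)+
qed

lemma word_ext_tens:
  "word_ext sM (word_form2 \<beta>) (tens t) =
    (\<Sum>(b, c)\<in>Poly_Mapping.keys t. sM (Poly_Mapping.lookup t (b, c)) (\<beta> b c))"
  by (simp add: tens_def word_ext_sweedler word_ext_letters2)

lemma word_ext_tens_coproduct: "word_ext sM (word_form2 \<beta>) (tens (\<Delta> a)) = cosum a \<beta>"
  by (simp add: word_ext_tens cosum_def)

lemmas tensor_square_eq = M.tensor_eq_word_ext[OF multilinear_word_form2]

lemma cosum_add:
  assumes "bilin sA sM \<beta>"
  shows "cosum (a + b) \<beta> = cosum a \<beta> + cosum b \<beta>"
  using tensor_square_eq[OF assms coproduct_add[of a b]]
  by (simp add: M.word_ext_add word_ext_tens_coproduct)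

lemma cosum_scale:
  assumes "bilin sA sM \<beta>"
  shows "cosum (sA c a) \<beta> = sM c (cosum a \<beta>)"
  using tensor_square_eq[OF assms coproduct_scale[of c a]]
  by (simp add: M.word_ext_const word_ext_tens_coproduct)

lemma cosum_mult:
  assumes "bilin sA sM \<beta>"
  shows "cosum (a * b) \<beta> = cosum a (\<lambda>a1 a2. cosum b (\<lambda>b1 b2. \<beta> (a1 * b1) (a2 * b2)))"
  using tensor_square_eq[OF assms coproduct_mult[of a b]]
  by (simp add: word_ext_sweedler word_ext_tens_coproduct word_ext_letters2 cosum_def)

lemma cosum_one:
  assumes "bilin sA sM \<beta>"
  shows "cosum 1 \<beta> = \<beta> 1 1"
  using tensor_square_eq[OF assms coproduct_one]
  by (simp add: word_ext_tens_coproduct word_ext_letters2)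

lemma cosum_cocommutative:
  assumes "bilin sA sM \<beta>"
  shows "cosum a \<beta> = cosum a (\<lambda>b c. \<beta> c b)"
  using tensor_square_eq[OF assms cocommutative[of a]]
  by (simp add: word_ext_sweedler word_ext_tens_coproduct word_ext_letters2 cosum_def)

lemma cosum_coassociative:
  assumes "\<And>a. bilin sA sM (\<gamma> a)" "\<And>c. bilin sA sM (\<lambda>a b. \<gamma> a b c)"
  shows "cosum a (\<lambda>a1 a2. cosum a1 (\<lambda>b c. \<gamma> b c a2)) = cosum a (\<lambda>a1 a2. cosum a2 (\<gamma> a1))"
proof -
  have "tens t * letter c = sweedler t (\<lambda>a b. letter a * letter b * letter c)"
    "letter c * tens t = sweedler t (\<lambda>a b. letter c * letter a * letter b)"
    for t :: "'a \<times> 'a \<Rightarrow>\<^sub>0 'k" and c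
    by (simp_all add: tens_def sweedler_def sum_distrib_left sum_distrib_right case_prod_beta
        mult.assoc mult_const_left_commute)
  then show ?thesis
    using M.tensor_eq_word_ext[OF multilinear_word_form3[OF assms] coassociative[of a]]
    by (simp add: word_ext_sweedler word_ext_letters3 cosum_def)
qed

text \<open>The inclusion \<open>\<Delta>(a) \<in> U \<otimes> U\<close> is used only in this dual form, which spares a construction of
  \<open>U \<otimes> U\<close> as a subspace of \<open>A \<otimes> A\<close>.\<close>

lemma cosum_vanishes:
  assumes "in_tensor_square sA U (\<Delta> a)" "bilin sA sM \<beta>"
    and "\<And>b c. b \<in> U \<Longrightarrow> c \<in> U \<Longrightarrow> \<beta> b c = 0"
  shows "cosum a \<beta> = 0"
proof -
  from assms(1) obtain u where u: "Poly_Mapping.keys u \<subseteq> U \<times> U" "tensor_eq sA (tens (\<Delta> a)) (tens u)"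
    by (auto simp: in_tensor_square_def)
  have "cosum a \<beta> = word_ext sM (word_form2 \<beta>) (tens u)"
    using tensor_square_eq[OF assms(2) u(2)] by (simp add: word_ext_tens_coproduct)
  also have "\<dots> = 0"
    unfolding word_ext_tens
    by (rule sum.neutral) (use u(1) assms(3) in \<open>fastforce simp: case_prod_beta\<close>)
  finally show ?thesis .
qed

lemma bilin_cosum:
  assumes "\<And>b c. bilin sA sM (\<lambda>x y. \<beta> x y b c)"
  shows "bilin sA sM (\<lambda>x y. cosum a (\<beta> x y))"
  by (rule bilinI)
     (simp_all add: bilinD[OF assms] cosum_def case_prod_beta sum.distrib
        M.scale_right_distrib M.scale_sum_right mult.commute)

end

section \<open>The smash product on polynomials\<close>

text \<open>The vector space underlying \<open>Sym(V) \<rtimes> A\<close> is modelled by finitely supported functions from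
  multisets of vectors to \<open>A\<close>: polynomials with coefficients in \<open>A\<close> and central variables, of which only those
  over the basis \<open>B\<close> matter. The multiplication of this type is that of \<open>Sym(V) \<otimes> A\<close>; the smash product
  appears through the operators \<open>act_poly a\<close> of left multiplication by \<open>a\<close>.\<close>

locale smash_model = cocommutative_algebra sA \<Delta> + V: vector_space sV
  for sA :: "'k::field \<Rightarrow> 'a::ring_1 \<Rightarrow> 'a"
    and \<Delta> :: "'a \<Rightarrow> ('a \<times> 'a \<Rightarrow>\<^sub>0 'k)"
    and sV :: "'k \<Rightarrow> 'v::ab_group_add \<Rightarrow> 'v" +
  fixes act :: "'a \<Rightarrow> 'v \<Rightarrow> 'v" and B :: "'v set"
  assumes module: "algebra_module sA sV act"
    and independent_B: "V.independent B" and span_B: "V.span B = UNIV"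
begin

lemma act_simps:
  "act (a + b) v = act a v + act b v" "act a (v + w) = act a v + act a w"
  "act (sA c a) v = sV c (act a v)" "act a (sV c v) = sV c (act a v)"
  "act 1 v = v" "act (a * b) v = act a (act b v)"
proof -
  note m = module[unfolded algebra_module_def bilinear_map_def]
  have 1: "Vector_Spaces.linear sV sV (act a)" and 2: "Vector_Spaces.linear sA sV (\<lambda>a. act a v)" for a v
    using m by auto
  show "act (a + b) v = act a v + act b v" "act (sA c a) v = sV c (act a v)"
    using 2[of v] by (auto simp: Vector_Spaces.linear_iff)
  show "act a (v + w) = act a v + act a w" "act a (sV c v) = sV c (act a v)"
    using 1[of a] by (auto simp: Vector_Spaces.linear_iff)
  show "act 1 v = v" "act (a * b) v = act a (act b v)"
    using m by auto
qed

lemma act_zero [simp]: "act 0 v = 0" "act a 0 = 0"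
  using act_simps(1)[of 0 0 v] act_simps(2)[of a 0 0] by auto

abbreviation emb :: "'a \<Rightarrow> ('v multiset \<Rightarrow>\<^sub>0 'a)"
  where "emb a \<equiv> Poly_Mapping.single {#} a"

definition scale_poly :: "'k \<Rightarrow> ('v multiset \<Rightarrow>\<^sub>0 'a) \<Rightarrow> ('v multiset \<Rightarrow>\<^sub>0 'a)"
  where "scale_poly c q = emb (sA c 1) * q"

lemma scale_poly_single: "scale_poly c (Poly_Mapping.single M d) = Poly_Mapping.single M (sA c d)"
  by (simp add: scale_poly_def mult_single scale_mult_left)

lemma scale_poly_commute: "scale_poly c q = q * emb (sA c 1)"
  by (induction q rule: poly_mapping_additive_induct)
     (simp_all add: scale_poly_def mult_single scale_mult_left scale_mult_right distrib_left distrib_right)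

lemma scale_poly_mult_left: "scale_poly c p * q = scale_poly c (p * q)"
  by (simp add: scale_poly_def mult.assoc)

lemma scale_poly_mult_right: "p * scale_poly c q = scale_poly c (p * q)"
  by (metis scale_poly_commute mult.assoc)

lemma vector_space_scale_poly: "vector_space scale_poly"
proof
  fix c d and p q :: "'v multiset \<Rightarrow>\<^sub>0 'a"
  show "scale_poly c (p + q) = scale_poly c p + scale_poly c q" by (simp add: scale_poly_def distrib_left)
  show "scale_poly (c + d) p = scale_poly c p + scale_poly d p"
    by (simp add: scale_poly_def scale_left_distrib single_add distrib_right)
  show "scale_poly c (scale_poly d p) = scale_poly (c * d) p"
    by (simp add: scale_poly_def mult.assoc[symmetric] mult_single scale_mult_left)
  show "scale_poly 1 p = p" by (simp add: scale_poly_def)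
qed

sublocale sweedler_calculus sA \<Delta> scale_poly
  by (rule sweedler_calculus.intro) (rule cocommutative_algebra_axioms, rule vector_space_scale_poly)

definition indet :: "'v \<Rightarrow> ('v multiset \<Rightarrow>\<^sub>0 'a)"
  where "indet b = Poly_Mapping.single {#b#} 1"

text \<open>The embedding of \<open>V\<close> as the linear forms in the variables, by coordinates with respect to \<open>B\<close>.\<close>

definition iota :: "'v \<Rightarrow> ('v multiset \<Rightarrow>\<^sub>0 'a)"
  where "iota w = (\<Sum>b | V.representation B w b \<noteq> 0. scale_poly (V.representation B w b) (indet b))"

lemma indet_central: "indet b * q = q * indet b"
  by (induction q rule: poly_mapping_additive_induct)
     (simp_all add: indet_def mult_single add.commute distrib_left distrib_right)

lemma iota_central: "iota w * q = q * iota w"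
  by (simp add: iota_def sum_distrib_left sum_distrib_right scale_poly_mult_left scale_poly_mult_right indet_central)

lemma iota_left_commute: "iota v * (iota w * q) = iota w * (iota v * q)"
  by (metis iota_central mult.assoc)

lemma iota_superset:
  assumes "finite F" "{b. V.representation B w b \<noteq> 0} \<subseteq> F"
  shows "iota w = (\<Sum>b\<in>F. scale_poly (V.representation B w b) (indet b))"
  unfolding iota_def by (rule sum.mono_neutral_left) (use assms in auto)

lemma iota_add: "iota (v + w) = iota v + iota w"
proof -
  let ?r = "V.representation B"
  let ?F = "{b. ?r v b \<noteq> 0} \<union> {b. ?r w b \<noteq> 0}"
  have r: "?r (v + w) b = ?r v b + ?r w b" for b
    using V.representation_add[OF independent_B, of w v] span_B by (simp add: add.commute)
  have fin: "finite ?F" by (simp add: V.finite_representation)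
  show ?thesis
    by (subst (1 2 3) iota_superset[OF fin]) (auto simp: r sum.distrib M.scale_left_distrib)
qed

lemma iota_scale: "iota (sV c v) = scale_poly c (iota v)"
proof -
  let ?r = "V.representation B"
  have r: "?r (sV c v) b = c * ?r v b" for b
    using V.representation_scale[OF independent_B, of v c] span_B by simp
  show ?thesis
    by (subst (1 2) iota_superset[of "{b. ?r v b \<noteq> 0}"])
       (auto simp: r M.scale_sum_right V.finite_representation)
qed

lemma iota_basis: "b \<in> B \<Longrightarrow> iota b = indet b"
  using V.representation_basis[OF independent_B, of b]
  by (subst iota_superset[of "{b}"]) auto

lemma iota_zero [simp]: "iota 0 = 0"
  using iota_add[of 0 0] by simp

text \<open>Multisets may contain vectors outside \<open>B\<close>, which are not images of anything under \<open>iota\<close>. Only on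
  polynomials over \<open>B\<close> does the unit of \<open>A\<close> act as the identity.\<close>

definition over_B :: "('v multiset \<Rightarrow>\<^sub>0 'a) \<Rightarrow> bool"
  where "over_B q \<longleftrightarrow> (\<forall>M\<in>Poly_Mapping.keys q. set_mset M \<subseteq> B)"

lemma over_B_add: "over_B p \<Longrightarrow> over_B q \<Longrightarrow> over_B (p + q)"
  using keys_add[of p q] by (auto simp: over_B_def)

lemma over_B_sum: "(\<And>x. x \<in> K \<Longrightarrow> over_B (f x)) \<Longrightarrow> over_B (sum f K)"
  by (induction K rule: infinite_finite_induct) (auto intro: over_B_add simp: over_B_def[of 0])

lemma over_B_mult: "over_B p \<Longrightarrow> over_B q \<Longrightarrow> over_B (p * q)"
  using keys_mult[of p q] by (fastforce simp: over_B_def)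

lemma over_B_single: "set_mset M \<subseteq> B \<Longrightarrow> over_B (Poly_Mapping.single M c)"
  by (auto simp: over_B_def split: if_splits)

lemma over_B_emb: "over_B (emb a)"
  by (rule over_B_single) simp

lemma over_B_scale_poly: "over_B q \<Longrightarrow> over_B (scale_poly c q)"
  unfolding scale_poly_def by (intro over_B_mult over_B_emb)

lemma over_B_iota: "over_B (iota w)"
  unfolding iota_def indet_def
  using V.representation_ne_zero[of B w]
  by (intro over_B_sum over_B_scale_poly over_B_single) auto

lemma over_B_cosum:
  assumes "\<And>b c. over_B (\<beta> b c)"
  shows "over_B (cosum a \<beta>)"
  unfolding cosum_def case_prod_beta by (intro over_B_sum over_B_scale_poly assms)

text \<open>\<open>act_word [v\<^sub>1, \<dots>, v\<^sub>n] a\<close> is \<open>a\<close> moved past the product \<open>v\<^sub>1 \<cdots> v\<^sub>n\<close>, that is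
  \<open>\<Sum> a\<^sub>1(v\<^sub>1) \<cdots> a\<^sub>n(v\<^sub>n) a\<^sub>n\<^sub>+\<^sub>1\<close>. On the empty word it is
  \<open>a\<close> itself, as befits the smash product with an algebra without counit.\<close>

primrec act_word :: "'v list \<Rightarrow> 'a \<Rightarrow> ('v multiset \<Rightarrow>\<^sub>0 'a)"
  where "act_word [] = emb"
  | "act_word (w # ws) = (\<lambda>a. cosum a (\<lambda>b c. iota (act b w) * act_word ws c))"

lemma bilin_iota:
  assumes "\<And>a b. f (a + b) = f a + f b" "\<And>c a. f (sA c a) = scale_poly c (f a)"
  shows "bilin sA scale_poly (\<lambda>b c. iota (act b w) * f c)"
  by (rule bilinI)
     (simp_all add: assms act_simps iota_add iota_scale distrib_left distrib_right scale_poly_mult_left scale_poly_mult_right)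

lemma act_word_linear: "act_word ws (a + b) = act_word ws a + act_word ws b" "act_word ws (sA c a) = scale_poly c (act_word ws a)"
proof -
  have "(\<forall>a b. act_word ws (a + b) = act_word ws a + act_word ws b) \<and> (\<forall>c a. act_word ws (sA c a) = scale_poly c (act_word ws a))"
  proof (induction ws)
    case Nil
    show ?case by (simp add: single_add scale_poly_single)
  next
    case (Cons w ws)
    then have "bilin sA scale_poly (\<lambda>b c. iota (act b w) * act_word ws c)"
      by (intro bilin_iota) auto
    then show ?case by (simp add: cosum_add cosum_scale)
  qed
  then show "act_word ws (a + b) = act_word ws a + act_word ws b" "act_word ws (sA c a) = scale_poly c (act_word ws a)" by auto
qed

lemma over_B_act_word: "over_B (act_word ws a)"
  by (induction ws arbitrary: a) (auto intro!: over_B_emb over_B_cosum over_B_mult over_B_iota)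

lemma cosum_mult_left: "p * cosum a \<beta> = cosum a (\<lambda>b c. p * \<beta> b c)"
  by (rule cosum_map) (simp_all add: distrib_left scale_poly_mult_right)

lemma cosum_mult_right: "cosum a \<beta> * p = cosum a (\<lambda>b c. \<beta> b c * p)"
  by (rule cosum_map[of "\<lambda>x. x * p"]) (simp_all add: distrib_right scale_poly_mult_left)

text \<open>Coassociativity lets the coproduct of the first leg feed both vectors, and
  cocommutativity then exchanges them. Consequently the action passes from words to commutative
  monomials.\<close>

lemma act_word_swap: "act_word (v # w # ws) a = act_word (w # v # ws) a"
proof -
  have assoc: "act_word (v # w # ws) a =
      cosum a (\<lambda>a1 a2. cosum a1 (\<lambda>b c. iota (act b v) * (iota (act c w) * act_word ws a2)))" for v w
  proof -
    have "cosum a (\<lambda>a1 a2. cosum a1 (\<lambda>b c. iota (act b v) * (iota (act c w) * act_word ws a2))) =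
        cosum a (\<lambda>a1 a2. cosum a2 (\<lambda>b c. iota (act a1 v) * (iota (act b w) * act_word ws c)))"
      by (rule cosum_coassociative; rule bilinI)
         (simp_all add: act_word_linear act_simps iota_add iota_scale distrib_left distrib_right
            scale_poly_mult_left scale_poly_mult_right)
    then show ?thesis by (simp add: cosum_mult_left)
  qed
  have "cosum a1 (\<lambda>b c. iota (act b v) * (iota (act c w) * act_word ws a2)) =
      cosum a1 (\<lambda>b c. iota (act b w) * (iota (act c v) * act_word ws a2))" for a1 a2
  proof -
    have "bilin sA scale_poly (\<lambda>b c. iota (act b v) * (iota (act c w) * act_word ws a2))"
      by (rule bilinI)
         (simp_all add: act_simps iota_add iota_scale distrib_left distrib_right scale_poly_mult_left scale_poly_mult_right)
    from cosum_cocommutative[OF this, of a1] show ?thesis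
      by (simp add: iota_left_commute)
  qed
  then show ?thesis by (simp only: assoc)
qed

lemma act_word_move: "act_word (us @ w # vs) a = act_word (w # us @ vs) a"
proof (induction us arbitrary: a)
  case (Cons u us)
  have "act_word ((u # us) @ w # vs) a = act_word (u # w # us @ vs) a"
    using Cons.IH by simp
  then show ?case by (simp only: act_word_swap append_Cons)
qed simp

lemma act_word_permute: "mset us = mset vs \<Longrightarrow> act_word us a = act_word vs a"
proof (induction us arbitrary: vs a)
  case (Cons u us)
  then have "u \<in> set vs" by (metis list.set_intros(1) set_mset_mset)
  then obtain v1 v2 where vs: "vs = v1 @ u # v2" by (meson split_list)
  then have eq: "mset us = mset (v1 @ v2)" using Cons.prems by simp
  have "act_word (u # us) a = act_word (u # v1 @ v2) a"
    using Cons.IH[OF eq] by simp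
  then show ?case by (simp only: vs act_word_move)
qed simp

definition listing :: "'v multiset \<Rightarrow> 'v list"
  where "listing M = (SOME l. mset l = M)"

lemma mset_listing [simp]: "mset (listing M) = M"
  unfolding listing_def using ex_mset by (rule someI_ex)

lemma listing_empty [simp]: "listing {#} = []"
  using mset_listing[of "{#}"] by (simp only: mset_zero_iff)

definition act_poly :: "'a \<Rightarrow> ('v multiset \<Rightarrow>\<^sub>0 'a) \<Rightarrow> ('v multiset \<Rightarrow>\<^sub>0 'a)"
  where "act_poly a = coeff_sum (\<lambda>M c. act_word (listing M) a * emb c)"

lemma act_poly_add_right: "act_poly a (p + q) = act_poly a p + act_poly a q"
  unfolding act_poly_def by (rule coeff_sum_add) (simp add: single_add distrib_left)

lemma act_poly_single: "act_poly a (Poly_Mapping.single M c) = act_word (listing M) a * emb c"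
  unfolding act_poly_def by (rule coeff_sum_single) simp

lemma act_poly_single_mset: "act_poly a (Poly_Mapping.single (mset ws) c) = act_word ws a * emb c"
  by (simp add: act_poly_single act_word_permute[of "listing (mset ws)" ws])

lemma act_poly_zero [simp]: "act_poly a 0 = 0"
  by (simp add: act_poly_def)

lemma act_poly_emb_right: "act_poly a (q * emb c) = act_poly a q * emb c"
  by (induction q rule: poly_mapping_additive_induct)
     (simp_all add: act_poly_single mult_single distrib_right act_poly_add_right mult.assoc)

lemma act_poly_emb: "act_poly a (emb c) = emb (a * c)"
  by (simp add: act_poly_single mult_single)

lemma act_poly_scale_poly: "act_poly a (scale_poly c q) = scale_poly c (act_poly a q)"
  by (simp add: scale_poly_commute act_poly_emb_right)

lemma act_poly_linear: "act_poly (a + b) q = act_poly a q + act_poly b q" "act_poly (sA c a) q = scale_poly c (act_poly a q)"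
  by (simp_all add: act_poly_def coeff_sum_def act_word_linear distrib_right sum.distrib scale_poly_mult_left M.scale_sum_right)

lemma act_poly_zero_left [simp]: "act_poly 0 q = 0"
  using act_poly_linear(1)[of 0 0 q] by simp

lemma over_B_act_poly: "over_B (act_poly a q)"
  unfolding act_poly_def coeff_sum_def by (intro over_B_sum over_B_mult over_B_act_word over_B_emb)

lemma bilin_iota_act_poly: "bilin sA scale_poly (\<lambda>b c. iota (act b w) * act_poly c q)"
  by (intro bilin_iota act_poly_linear)

lemma act_poly_iota_basis: "b \<in> B \<Longrightarrow> act_poly a (indet b * q) = cosum a (\<lambda>x y. iota (act x b) * act_poly y q)"
proof (induction q rule: poly_mapping_additive_induct)
  case (single M c)
  have "act_poly a (indet b * Poly_Mapping.single M c) = act_poly a (Poly_Mapping.single (mset (b # listing M)) c)"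
    by (simp add: indet_def mult_single)
  also have "\<dots> = cosum a (\<lambda>x y. iota (act x b) * act_poly y (Poly_Mapping.single M c))"
    unfolding act_poly_single_mset by (simp add: act_poly_single cosum_mult_right mult.assoc)
  finally show ?case .
next
  case (add p q)
  then show ?case by (simp add: distrib_left act_poly_add_right cosum_add_fun)
qed

text \<open>The cross relation \<open>a w = \<Sum> a\<^sub>1(w) a\<^sub>2\<close>. For a variable it is the recursion of
  \<open>act_word\<close>, read on a monomial with that variable listed first; both sides are linear in \<open>w\<close>.\<close>

lemma act_poly_iota: "act_poly a (iota w * q) = cosum a (\<lambda>x y. iota (act x w) * act_poly y q)"
proof -
  have "w \<in> V.span B" by (simp add: span_B)
  then show ?thesis
  proof (induction rule: V.span_induct)
    case base
    show ?case
      by (simp add: V.subspace_def cosum_zero_fun act_simps iota_add iota_scale distrib_right act_poly_add_right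
          cosum_add_fun scale_poly_mult_left act_poly_scale_poly cosum_scale_fun)
  next
    case (step b)
    then show ?case by (simp add: act_poly_iota_basis[of b] iota_basis)
  qed
qed

lemma act_poly_cosum: "act_poly a (cosum b \<beta>) = cosum b (\<lambda>x y. act_poly a (\<beta> x y))"
  by (rule cosum_map) (simp_all add: act_poly_add_right act_poly_scale_poly)

lemma act_poly_act_word: "act_poly a (act_word ws b) = act_word ws (a * b)"
proof (induction ws arbitrary: a b)
  case Nil
  then show ?case by (simp add: act_poly_emb)
next
  case (Cons w ws)
  have "act_poly a (act_word (w # ws) b) = cosum b (\<lambda>b1 b2. cosum a (\<lambda>a1 a2. iota (act a1 (act b1 w)) * act_word ws (a2 * b2)))"
    by (simp add: act_poly_cosum act_poly_iota Cons.IH)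
  also have "\<dots> = cosum a (\<lambda>a1 a2. cosum b (\<lambda>b1 b2. iota (act a1 (act b1 w)) * act_word ws (a2 * b2)))"
    unfolding cosum_def case_prod_beta M.scale_sum_right
    by (subst sum.swap) (simp add: mult.commute)
  also have "\<dots> = act_word (w # ws) (a * b)"
    by (simp add: cosum_mult[OF bilin_iota[OF act_word_linear]] act_simps)
  finally show ?case .
qed

lemma act_poly_mult: "act_poly a (act_poly b q) = act_poly (a * b) q"
  by (induction q rule: poly_mapping_additive_induct)
     (simp_all add: act_poly_single act_poly_emb_right act_poly_act_word act_poly_add_right)

lemma act_poly_one: "over_B q \<Longrightarrow> act_poly 1 q = q"
proof -
  have tau1: "act_word ws 1 = Poly_Mapping.single (mset ws) 1" if "set ws \<subseteq> B" for ws
    using that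
  proof (induction ws)
    case (Cons w ws)
    then show ?case
      by (simp add: cosum_one[OF bilin_iota[OF act_word_linear]] act_simps iota_basis indet_def mult_single)
  qed simp
  assume q: "over_B q"
  have "act_poly 1 q = (\<Sum>M\<in>Poly_Mapping.keys q. Poly_Mapping.single M (Poly_Mapping.lookup q M))"
    unfolding act_poly_def coeff_sum_def
  proof (rule sum.cong[OF refl])
    fix M assume "M \<in> Poly_Mapping.keys q"
    then have "set (listing M) \<subseteq> B"
      using q by (metis over_B_def mset_listing set_mset_mset)
    then show "act_word (listing M) 1 * emb (Poly_Mapping.lookup q M) = Poly_Mapping.single M (Poly_Mapping.lookup q M)"
      by (simp add: tau1 mult_single)
  qed
  then show ?thesis by (simp add: sum_singles)
qed

end

section \<open>Congruence modulo an ideal\<close>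

locale type_ideal =
  fixes I :: "'r::ring_1 set"
  assumes ideal: "ideal I ring_of_type_algebra"
begin

lemma zero_mem: "0 \<in> I" and add_mem: "x \<in> I \<Longrightarrow> y \<in> I \<Longrightarrow> x + y \<in> I"
  and mult_left_mem: "x \<in> I \<Longrightarrow> r * x \<in> I" and mult_right_mem: "x \<in> I \<Longrightarrow> x * r \<in> I"
  using ideal by (auto simp: ideal_type_ring_iff)

lemma uminus_mem: "x \<in> I \<Longrightarrow> - x \<in> I"
  using mult_left_mem[of x "- 1"] by simp

definition eqv :: "'r \<Rightarrow> 'r \<Rightarrow> bool"
  where "eqv p q \<longleftrightarrow> p - q \<in> I"

lemma eqv_refl [simp]: "eqv p p"
  by (simp add: eqv_def zero_mem)

lemma eqv_sym: "eqv p q \<Longrightarrow> eqv q p"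
  using uminus_mem[of "p - q"] by (simp add: eqv_def)

lemma eqv_trans [trans]: "eqv p q \<Longrightarrow> eqv q r \<Longrightarrow> eqv p r"
  using add_mem[of "p - q" "q - r"] by (simp add: eqv_def)

lemma eqv_add: "eqv p q \<Longrightarrow> eqv p' q' \<Longrightarrow> eqv (p + p') (q + q')"
  using add_mem[of "p - q" "p' - q'"] by (simp add: eqv_def algebra_simps)

lemma eqv_uminus: "eqv p q \<Longrightarrow> eqv (- p) (- q)"
  using uminus_mem[of "p - q"] by (simp add: eqv_def algebra_simps)

lemma eqv_diff: "eqv p q \<Longrightarrow> eqv p' q' \<Longrightarrow> eqv (p - p') (q - q')"
  using eqv_add[OF _ eqv_uminus, of p q p' q'] by simp

lemma eqv_mult:
  assumes "eqv p q" "eqv p' q'"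
  shows "eqv (p * p') (q * q')"
proof -
  have "p * p' - q * q' = (p - q) * p' + q * (p' - q')"
    by (simp add: algebra_simps)
  then show ?thesis
    using assms by (simp add: eqv_def add_mem mult_left_mem mult_right_mem)
qed

lemma eqv_sum: "(\<And>x. x \<in> K \<Longrightarrow> eqv (f x) (g x)) \<Longrightarrow> eqv (sum f K) (sum g K)"
  by (induction K rule: infinite_finite_induct) (auto intro: eqv_add)

lemma mem_iff_eqv_zero: "p \<in> I \<longleftrightarrow> eqv p 0"
  by (simp add: eqv_def)

lemma eqv_mem_iff: "eqv p q \<Longrightarrow> p \<in> I \<longleftrightarrow> q \<in> I"
  unfolding mem_iff_eqv_zero by (blast intro: eqv_trans eqv_sym)

end

lemma type_ideal_genideal: "type_ideal (genideal (ring_of_type_algebra :: 'r::ring_1 ring) S)"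
proof (rule type_ideal.intro)
  interpret ring "ring_of_type_algebra :: 'r ring" by (rule ring_type_ring)
  show "ideal (genideal (ring_of_type_algebra :: 'r ring) S) ring_of_type_algebra"
    by (rule genideal_ideal) simp
qed

lemma genideal_type_ring_base: "S \<subseteq> genideal (ring_of_type_algebra :: 'r::ring_1 ring) S"
proof -
  interpret ring "ring_of_type_algebra :: 'r ring" by (rule ring_type_ring)
  show ?thesis by (rule genideal_self) simp
qed

lemma freealg_induct [case_names const letter add]:
  fixes p :: "('x, 'k::field) freealg"
  assumes const: "\<And>c. P (const c)" and letter: "\<And>x p. P p \<Longrightarrow> P (letter x * p)"
    and add: "\<And>p q. P p \<Longrightarrow> P q \<Longrightarrow> P (p + q)"
  shows "P p"
proof (induction p rule: poly_mapping_additive_induct)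
  case (single w c)
  show ?case
    by (induction w) (simp_all add: single_Nil_eq_const single_Cons_eq_letter const letter)
qed (rule add)

section \<open>Relations in the algebras with given structure constants\<close>

locale structure_relations = V: vector_space sV + A: vector_space sA
  for sA :: "'k::field \<Rightarrow> 'a::ring_1 \<Rightarrow> 'a"
    and sV :: "'k \<Rightarrow> 'v::ab_group_add \<Rightarrow> 'v" +
  fixes \<Delta> :: "'a \<Rightarrow> ('a \<times> 'a \<Rightarrow>\<^sub>0 'k)" and act :: "'a \<Rightarrow> 'v \<Rightarrow> 'v"
    and lam :: "'a \<Rightarrow> 'v \<Rightarrow> 'a" and kap :: "'v \<Rightarrow> 'v \<Rightarrow> 'v \<times> 'a"
begin

sublocale type_ideal "hideal sA \<Delta> sV act lam kap"
  unfolding hideal_def by (rule type_ideal_genideal)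

lemma relation_mem:
  assumes "r \<in> tensor_relations (module_prod.scale sV sA) \<union> hrelations \<Delta> act lam kap"
  shows "r \<in> hideal sA \<Delta> sV act lam kap"
  using assms genideal_type_ring_base unfolding hideal_def by blast

lemma letter_add: "eqv (letter (x + y)) (letter x + letter y)"
proof -
  have "letter (x + y) - letter x - letter y \<in> hideal sA \<Delta> sV act lam kap"
    by (rule relation_mem) (unfold tensor_relations_def, blast)
  then show ?thesis by (simp add: eqv_def diff_diff_eq)
qed

lemma scale_pair: "module_prod.scale sV sA c (v, a) = (sV c v, sA c a)"
proof -
  interpret module_prod sV sA by unfold_locales
  show ?thesis by (rule scale_prod)
qed

lemma letter_scale: "eqv (letter (sV c v, sA c a)) (const c * letter (v, a))"
proof -
  have "letter (module_prod.scale sV sA c (v, a)) - const c * letter (v, a) \<in> hideal sA \<Delta> sV act lam kap"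
    by (rule relation_mem) (unfold tensor_relations_def, blast)
  then show ?thesis by (simp add: eqv_def scale_pair)
qed

lemma letter_zero: "eqv (letter (0, 0)) 0"
  using letter_scale[of 0 0 0] by (simp add: const_simps)

lemma letter_split: "eqv (letter (v, a)) (letter (v, 0) + letter (0, a))"
  using letter_add[of "(v, 0)" "(0, a)"] by simp

lemma letter_A_add: "eqv (letter (0, a + b)) (letter (0, a) + letter (0, b))"
  using letter_add[of "(0, a)" "(0, b)"] by simp

lemma letter_V_scale: "eqv (letter (sV c v, 0)) (const c * letter (v, 0))"
  using letter_scale[of c v 0] by simp

lemma letter_V_sum: "eqv (letter (sum f K, 0)) (\<Sum>x\<in>K. letter (f x, 0))"
proof (induction K rule: infinite_finite_induct)
  case (insert x K)
  have "eqv (letter (f x + sum f K, 0)) (letter (f x, 0) + letter (sum f K, 0))"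
    using letter_add[of "(f x, 0)" "(sum f K, 0)"] by simp
  also have "eqv \<dots> (letter (f x, 0) + (\<Sum>x\<in>K. letter (f x, 0)))"
    by (intro eqv_add insert.IH eqv_refl)
  finally show ?case using insert by simp
qed (simp_all add: letter_zero)

lemma letter_A_mult: "eqv (letter (0, a) * letter (0, b)) (letter (0, a * b))"
  unfolding eqv_def by (rule relation_mem) (auto simp: hrelations_def)

lemma letter_one: "eqv (letter (0, 1)) 1"
  unfolding eqv_def by (rule relation_mem) (auto simp: hrelations_def)

lemma const_eqv_letter: "eqv (const c) (letter (0, sA c 1))"
proof -
  have "eqv (letter (0, sA c 1)) (const c * letter (0, 1))"
    using letter_scale[of c 0 1] by simp
  also have "eqv \<dots> (const c * 1)"
    by (intro eqv_mult letter_one eqv_refl)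
  finally show ?thesis by (simp add: eqv_sym)
qed

lemma letter_cross:
  "eqv (letter (0, a) * letter (v, 0))
    (sweedler (\<Delta> a) (\<lambda>a1 a2. letter (act a1 v, 0) * letter (0, a2)) + letter (0, lam a v))"
proof -
  have "letter (0, a) * letter (v, 0) - sweedler (\<Delta> a) (\<lambda>a1 a2. letter (act a1 v, 0) * letter (0, a2))
      - letter (0, lam a v) \<in> hideal sA \<Delta> sV act lam kap"
    by (rule relation_mem) (unfold hrelations_def, blast)
  then show ?thesis by (simp add: eqv_def diff_diff_eq)
qed

lemma letter_commutator:
  "eqv (letter (v, 0) * letter (w, 0)) (letter (w, 0) * letter (v, 0) + letter (kap v w))"
proof -
  have "letter (v, 0) * letter (w, 0) - letter (w, 0) * letter (v, 0) - letter (kap v w)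
      \<in> hideal sA \<Delta> sV act lam kap"
    by (rule relation_mem) (unfold hrelations_def, blast)
  then show ?thesis by (simp add: eqv_def diff_diff_eq)
qed

end

section \<open>The polynomial model is the smash product\<close>

context smash_model
begin

sublocale I0: structure_relations sA sV \<Delta> act "\<lambda>_ _. 0" "\<lambda>_ _. 0"
  by unfold_locales

abbreviation "I0 \<equiv> hideal sA \<Delta> sV act (\<lambda>_ _. 0) (\<lambda>_ _. 0)"

text \<open>The letter \<open>(v, a)\<close> acts by multiplication with \<open>v\<close> plus the action of \<open>a\<close>, and \<open>Phi\<close> extends this to
  a representation of the free algebra.\<close>

definition step :: "'v \<times> 'a \<Rightarrow> ('v multiset \<Rightarrow>\<^sub>0 'a) \<Rightarrow> ('v multiset \<Rightarrow>\<^sub>0 'a)"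
  where "step x q = iota (fst x) * q + act_poly (snd x) q"

definition Phi :: "('v \<times> 'a, 'k) freealg \<Rightarrow> ('v multiset \<Rightarrow>\<^sub>0 'a) \<Rightarrow> ('v multiset \<Rightarrow>\<^sub>0 'a)"
  where "Phi p q = word_ext scale_poly (\<lambda>w. foldr step w q) p"

lemma step_linear:
  "step x (p + q) = step x p + step x q" "step x (scale_poly c q) = scale_poly c (step x q)"
  "step x (q * emb a) = step x q * emb a"
  by (simp_all add: step_def distrib_left distrib_right act_poly_add_right act_poly_scale_poly act_poly_emb_right scale_poly_mult_right
      M.scale_right_distrib mult.assoc)

lemma Phi_add: "Phi (p + p') q = Phi p q + Phi p' q"
  and Phi_diff: "Phi (p - p') q = Phi p q - Phi p' q"
  and Phi_sum: "Phi (sum g K) q = (\<Sum>x\<in>K. Phi (g x) q)"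
  and Phi_const: "Phi (const c * p) q = scale_poly c (Phi p q)"
  by (simp_all add: Phi_def M.word_ext_add M.word_ext_diff M.word_ext_sum M.word_ext_const)

lemma Phi_zero [simp]: "Phi 0 q = 0"
  by (simp add: Phi_def word_ext_def)

lemma Phi_one [simp]: "Phi 1 q = q"
  by (simp add: Phi_def M.word_ext_single flip: const_one single_Nil_eq_const)

lemma Phi_letter_mult: "Phi (letter x * p) q = step x (Phi p q)"
proof (induction p rule: poly_mapping_additive_induct)
  case (single w c)
  then show ?case
    by (simp add: Phi_def M.word_ext_single step_linear flip: single_Cons_eq_letter)
qed (simp add: distrib_left Phi_add step_linear)

lemma Phi_letter: "Phi (letter x) q = step x q"
  using Phi_letter_mult[of x 1] by simp

lemma Phi_mult: "Phi (p * r) q = Phi p (Phi r q)"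
proof (induction p rule: freealg_induct)
  case (const c)
  show ?case using Phi_const[of c 1] by (simp add: Phi_const)
qed (simp_all add: Phi_letter_mult mult.assoc distrib_right Phi_add)

lemma Phi_right_linear:
  "Phi p (q + r) = Phi p q + Phi p r" "Phi p (q * emb a) = Phi p q * emb a"
proof (induction p rule: freealg_induct)
  case (const c)
  { case 1 then show ?case using Phi_const[of c 1] by (simp add: M.scale_right_distrib) }
  { case 2 then show ?case using Phi_const[of c 1] by (simp add: scale_poly_mult_left) }
qed (simp_all add: Phi_letter_mult Phi_add step_linear distrib_right)

lemma Phi_right_zero [simp]: "Phi p 0 = 0"
  using Phi_right_linear(1)[of p 0 0] by simp

lemma over_B_step: "over_B q \<Longrightarrow> over_B (step x q)"
  unfolding step_def by (intro over_B_add over_B_mult over_B_iota over_B_act_poly)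

lemma over_B_Phi: "over_B q \<Longrightarrow> over_B (Phi p q)"
proof (induction p rule: freealg_induct)
  case (const c)
  then show ?case using Phi_const[of c 1] by (simp add: over_B_scale_poly)
qed (simp_all add: Phi_letter_mult Phi_add over_B_step over_B_add)

lemma Phi_sweedler: "Phi (sweedler (\<Delta> a) f) q = cosum a (\<lambda>b c. Phi (f b c) q)"
  unfolding Phi_def word_ext_sweedler cosum_def ..

lemma step_V: "step (v, 0) q = iota v * q" and step_A: "step (0, a) q = act_poly a q"
  by (simp_all add: step_def)

text \<open>The structure relations with zero parameters hold for the operators \<^const>\<open>step\<close>, so the
  polynomials over \<open>B\<close> form a module over the quotient.\<close>

lemma Phi_I0:
  assumes "p \<in> I0" "over_B q"
  shows "Phi p q = 0"
proof -
  define J where "J = {p. \<forall>q. over_B q \<longrightarrow> Phi p q = 0}"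
  have sub: "tensor_relations (module_prod.scale sV sA) \<union> hrelations \<Delta> act (\<lambda>_ _. 0) (\<lambda>_ _. 0) \<subseteq> J"
  proof
    fix r assume "r \<in> tensor_relations (module_prod.scale sV sA) \<union> hrelations \<Delta> act (\<lambda>_ _. 0) (\<lambda>_ _. 0)"
    then consider x y where "r = letter (x + y) - letter x - letter y"
      | c v a where "r = letter (module_prod.scale sV sA c (v, a)) - const c * letter (v, a)"
      | a b where "r = letter (0, a) * letter (0, b) - letter (0, a * b)"
      | "r = letter (0, 1) - 1"
      | a v where "r = letter (0, a) * letter (v, 0)
          - sweedler (\<Delta> a) (\<lambda>a1 a2. letter (act a1 v, 0) * letter (0, a2)) - letter (0, 0)"
      | v w where "r = letter (v, 0) * letter (w, 0) - letter (w, 0) * letter (v, 0) - letter 0"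
      unfolding tensor_relations_def hrelations_def by fast
    then show "r \<in> J"
    proof cases
      case 1
      then show ?thesis
        by (simp add: J_def Phi_diff Phi_letter step_def iota_add act_poly_linear distrib_right)
    next
      case 2
      then show ?thesis
        by (simp add: J_def I0.scale_pair Phi_diff Phi_letter Phi_const step_def iota_scale act_poly_linear
            scale_poly_mult_left M.scale_right_distrib)
    next
      case 3
      then show ?thesis
        by (simp add: J_def Phi_diff Phi_letter Phi_mult step_A act_poly_mult)
    next
      case 4
      then show ?thesis
        by (simp add: J_def Phi_diff Phi_letter step_A act_poly_one)
    next
      case 5
      then show ?thesis
        by (simp add: J_def Phi_diff Phi_letter Phi_mult step_A step_V Phi_sweedler act_poly_iota)
    next
      case 6
      then show ?thesis
        by (simp add: J_def Phi_diff Phi_letter Phi_mult step_V iota_left_commute step_def[of 0])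
    qed
  qed
  have mem: "p \<in> genideal ring_of_type_algebra
      (tensor_relations (module_prod.scale sV sA) \<union> hrelations \<Delta> act (\<lambda>_ _. 0) (\<lambda>_ _. 0))"
    using assms(1) by (simp add: hideal_def)
  have "p \<in> J"
    by (rule genideal_type_ring_minimal[OF mem sub])
       (auto simp: J_def Phi_add Phi_mult over_B_Phi)
  then show ?thesis using assms(2) by (simp add: J_def)
qed

definition V_word :: "'v list \<Rightarrow> ('v \<times> 'a, 'k) freealg"
  where "V_word ws = prod_list (map (\<lambda>v. letter (v, 0)) ws)"

lemma V_word_simps [simp]: "V_word [] = 1" "V_word (w # ws) = letter (w, 0) * V_word ws"
  by (simp_all add: V_word_def)

lemma V_letters_commute: "I0.eqv (letter (v, 0) * letter (w, 0)) (letter (w, 0) * letter (v, 0))"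
proof -
  have "I0.eqv (letter (v, 0) * letter (w, 0)) (letter (w, 0) * letter (v, 0) + letter (0, 0))"
    using I0.letter_commutator[of v w] by (simp add: zero_prod_def)
  also have "I0.eqv \<dots> (letter (w, 0) * letter (v, 0) + 0)"
    by (intro I0.eqv_add I0.letter_zero I0.eqv_refl)
  finally show ?thesis by simp
qed

lemma V_word_move: "I0.eqv (V_word (us @ w # vs)) (letter (w, 0) * V_word (us @ vs))"
proof (induction us)
  case (Cons u us)
  have "I0.eqv (letter (u, 0) * V_word (us @ w # vs)) (letter (u, 0) * (letter (w, 0) * V_word (us @ vs)))"
    by (intro I0.eqv_mult Cons.IH I0.eqv_refl)
  also have "\<dots> = (letter (u, 0) * letter (w, 0)) * V_word (us @ vs)"
    by (simp add: mult.assoc)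
  also have "I0.eqv \<dots> ((letter (w, 0) * letter (u, 0)) * V_word (us @ vs))"
    by (intro I0.eqv_mult V_letters_commute I0.eqv_refl)
  finally show ?case by (simp add: mult.assoc)
qed simp

lemma V_word_permute: "mset us = mset vs \<Longrightarrow> I0.eqv (V_word us) (V_word vs)"
proof (induction us arbitrary: vs)
  case (Cons u us)
  then have "u \<in> set vs" by (metis list.set_intros(1) set_mset_mset)
  then obtain v1 v2 where vs: "vs = v1 @ u # v2" by (meson split_list)
  then have eq: "mset us = mset (v1 @ v2)" using Cons.prems by simp
  have "I0.eqv (V_word (u # us)) (letter (u, 0) * V_word (v1 @ v2))"
    using Cons.IH[OF eq] by (simp add: I0.eqv_mult)
  also have "I0.eqv \<dots> (V_word vs)"
    unfolding vs by (rule I0.eqv_sym[OF V_word_move])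
  finally show ?case .
qed simp

text \<open>A right inverse of \<open>p \<mapsto> Phi p 1\<close>: monomials are written out as words in \<open>V\<close> followed by
  one letter of \<open>A\<close>. It is additive only modulo the ideal, because letters are.\<close>

definition normal_form :: "('v multiset \<Rightarrow>\<^sub>0 'a) \<Rightarrow> ('v \<times> 'a, 'k) freealg"
  where "normal_form = coeff_sum (\<lambda>M c. V_word (listing M) * letter (0, c))"

lemma normal_form_superset:
  assumes "finite F" "Poly_Mapping.keys q \<subseteq> F"
  shows "I0.eqv (normal_form q) (\<Sum>M\<in>F. V_word (listing M) * letter (0, Poly_Mapping.lookup q M))"
proof -
  let ?f = "\<lambda>M. V_word (listing M) * letter (0, Poly_Mapping.lookup q M)"
  have "I0.eqv (sum ?f (F - Poly_Mapping.keys q)) (\<Sum>M\<in>F - Poly_Mapping.keys q. 0)"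
  proof (rule I0.eqv_sum)
    fix M assume "M \<in> F - Poly_Mapping.keys q"
    then have "Poly_Mapping.lookup q M = 0" by (simp add: in_keys_iff)
    then show "I0.eqv (?f M) 0"
      using I0.eqv_mult[OF I0.eqv_refl[of "V_word (listing M)"] I0.letter_zero] by simp
  qed
  then have "I0.eqv (sum ?f (Poly_Mapping.keys q) + 0)
      (sum ?f (Poly_Mapping.keys q) + sum ?f (F - Poly_Mapping.keys q))"
    by (intro I0.eqv_add I0.eqv_refl) (auto intro: I0.eqv_sym)
  also have "\<dots> = sum ?f F"
    using assms by (simp add: sum.subset_diff add.commute)
  finally show ?thesis by (simp add: normal_form_def coeff_sum_def)
qed

lemma normal_form_add: "I0.eqv (normal_form (p + q)) (normal_form p + normal_form q)"
proof -
  let ?F = "Poly_Mapping.keys p \<union> Poly_Mapping.keys q"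
  let ?g = "\<lambda>q M. V_word (listing M) * letter (0, Poly_Mapping.lookup q M)"
  have "I0.eqv (normal_form (p + q)) (sum (?g (p + q)) ?F)"
    by (rule normal_form_superset) (auto simp: keys_add)
  also have "I0.eqv \<dots> (\<Sum>M\<in>?F. ?g p M + ?g q M)"
  proof (rule I0.eqv_sum)
    fix M
    show "I0.eqv (?g (p + q) M) (?g p M + ?g q M)"
      using I0.eqv_mult[OF I0.eqv_refl[of "V_word (listing M)"] I0.letter_A_add]
      by (simp add: lookup_add distrib_left)
  qed
  also have "\<dots> = sum (?g p) ?F + sum (?g q) ?F" by (rule sum.distrib)
  also have "I0.eqv \<dots> (normal_form p + normal_form q)"
    by (intro I0.eqv_add I0.eqv_sym[OF normal_form_superset]) auto
  finally show ?thesis .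
qed

lemma normal_form_zero [simp]: "normal_form 0 = 0"
  by (simp add: normal_form_def)

lemma normal_form_sum: "I0.eqv (normal_form (sum f K)) (\<Sum>x\<in>K. normal_form (f x))"
proof (induction K rule: infinite_finite_induct)
  case (insert x K)
  have "I0.eqv (normal_form (f x + sum f K)) (normal_form (f x) + normal_form (sum f K))" by (rule normal_form_add)
  also have "I0.eqv \<dots> (normal_form (f x) + (\<Sum>x\<in>K. normal_form (f x)))"
    by (intro I0.eqv_add insert.IH I0.eqv_refl)
  finally show ?case using insert by simp
qed simp_all

lemma normal_form_single: "I0.eqv (normal_form (Poly_Mapping.single M c)) (V_word (listing M) * letter (0, c))"
  using normal_form_superset[of "{M}" "Poly_Mapping.single M c"] by simp

lemma normal_form_map:
  assumes add: "\<And>p q. f (p + q) = f p + f q"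
    and single: "\<And>M c. I0.eqv (normal_form (f (Poly_Mapping.single M c))) (u * (V_word (listing M) * letter (0, c)) * r)"
  shows "I0.eqv (normal_form (f q)) (u * normal_form q * r)"
proof (induction q rule: poly_mapping_additive_induct)
  case (single M c)
  have "I0.eqv (u * (V_word (listing M) * letter (0, c)) * r) (u * normal_form (Poly_Mapping.single M c) * r)"
    by (intro I0.eqv_mult I0.eqv_refl I0.eqv_sym[OF normal_form_single])
  then show ?case by (rule I0.eqv_trans[OF assms(2)])
next
  case (add p q)
  have "I0.eqv (normal_form (f (p + q))) (normal_form (f p) + normal_form (f q))"
    unfolding assms(1) by (rule normal_form_add)
  also have "I0.eqv \<dots> (u * normal_form p * r + u * normal_form q * r)"
    by (intro I0.eqv_add add)
  also have "\<dots> = u * (normal_form p + normal_form q) * r" by (simp add: algebra_simps)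
  also have "I0.eqv \<dots> (u * normal_form (p + q) * r)"
    by (intro I0.eqv_mult I0.eqv_refl I0.eqv_sym[OF normal_form_add])
  finally show ?case .
qed

lemma normal_form_emb: "I0.eqv (normal_form (q * emb c)) (normal_form q * letter (0, c))"
proof -
  have "I0.eqv (normal_form (q * emb c)) (1 * normal_form q * letter (0, c))"
  proof (rule normal_form_map[of "\<lambda>q. q * emb c"])
    fix M d
    have "I0.eqv (normal_form (Poly_Mapping.single M d * emb c)) (V_word (listing M) * letter (0, d * c))"
      using normal_form_single[of M "d * c"] by (simp add: mult_single)
    also have "I0.eqv \<dots> (V_word (listing M) * (letter (0, d) * letter (0, c)))"
      by (intro I0.eqv_mult I0.eqv_refl I0.eqv_sym[OF I0.letter_A_mult])
    finally show "I0.eqv (normal_form (Poly_Mapping.single M d * emb c))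
        (1 * (V_word (listing M) * letter (0, d)) * letter (0, c))"
      by (simp add: mult.assoc)
  qed (rule distrib_right)
  then show ?thesis by simp
qed

lemma normal_form_scale_poly: "I0.eqv (normal_form (scale_poly c q)) (const c * normal_form q)"
proof -
  have "I0.eqv (normal_form (scale_poly c q)) (normal_form q * letter (0, sA c 1))"
    unfolding scale_poly_commute by (rule normal_form_emb)
  also have "I0.eqv \<dots> (normal_form q * const c)"
    by (intro I0.eqv_mult I0.eqv_refl I0.eqv_sym[OF I0.const_eqv_letter])
  finally show ?thesis by (simp add: const_central)
qed

lemma normal_form_indet: "I0.eqv (normal_form (indet b * q)) (letter (b, 0) * normal_form q)"
proof -
  have "I0.eqv (normal_form (indet b * q)) (letter (b, 0) * normal_form q * 1)"
  proof (rule normal_form_map)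
    fix M c
    have "I0.eqv (normal_form (indet b * Poly_Mapping.single M c)) (V_word (listing (add_mset b M)) * letter (0, c))"
      using normal_form_single[of "add_mset b M" c] by (simp add: indet_def mult_single)
    also have "I0.eqv \<dots> (V_word (b # listing M) * letter (0, c))"
      by (intro I0.eqv_mult I0.eqv_refl V_word_permute) simp
    finally show "I0.eqv (normal_form (indet b * Poly_Mapping.single M c))
        (letter (b, 0) * (V_word (listing M) * letter (0, c)) * 1)"
      by (simp add: mult.assoc)
  qed (rule distrib_left)
  then show ?thesis by simp
qed

lemma normal_form_iota: "I0.eqv (normal_form (iota w * q)) (letter (w, 0) * normal_form q)"
proof -
  let ?r = "V.representation B w"
  let ?F = "{b. ?r b \<noteq> 0}"
  have "I0.eqv (normal_form (iota w * q)) (\<Sum>b\<in>?F. normal_form (scale_poly (?r b) (indet b * q)))"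
    using normal_form_sum[of "\<lambda>b. scale_poly (?r b) (indet b * q)" ?F]
    by (simp add: iota_def sum_distrib_right scale_poly_mult_left)
  also have "I0.eqv \<dots> (\<Sum>b\<in>?F. letter (sV (?r b) b, 0) * normal_form q)"
  proof (rule I0.eqv_sum)
    fix b
    have "I0.eqv (normal_form (scale_poly (?r b) (indet b * q))) (const (?r b) * normal_form (indet b * q))"
      by (rule normal_form_scale_poly)
    also have "I0.eqv \<dots> (const (?r b) * (letter (b, 0) * normal_form q))"
      by (intro I0.eqv_mult I0.eqv_refl normal_form_indet)
    also have "\<dots> = (const (?r b) * letter (b, 0)) * normal_form q" by (simp add: mult.assoc)
    also have "I0.eqv \<dots> (letter (sV (?r b) b, 0) * normal_form q)"
      by (intro I0.eqv_mult I0.eqv_refl I0.eqv_sym[OF I0.letter_V_scale])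
    finally show "I0.eqv (normal_form (scale_poly (?r b) (indet b * q))) (letter (sV (?r b) b, 0) * normal_form q)" .
  qed
  also have "\<dots> = (\<Sum>b\<in>?F. letter (sV (?r b) b, 0)) * normal_form q" by (simp add: sum_distrib_right)
  also have "I0.eqv \<dots> (letter (\<Sum>b\<in>?F. sV (?r b) b, 0) * normal_form q)"
    by (intro I0.eqv_mult I0.eqv_refl I0.eqv_sym[OF I0.letter_V_sum])
  also have "(\<Sum>b\<in>?F. sV (?r b) b) = w"
    using V.sum_nonzero_representation_eq[OF independent_B] span_B by simp
  finally show ?thesis .
qed

lemma letter_cross_0:
  "I0.eqv (letter (0, a) * letter (v, 0)) (sweedler (\<Delta> a) (\<lambda>a1 a2. letter (act a1 v, 0) * letter (0, a2)))"
proof -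
  note I0.letter_cross[of a v]
  also have "I0.eqv (sweedler (\<Delta> a) (\<lambda>a1 a2. letter (act a1 v, 0) * letter (0, a2)) + letter (0, 0))
      (sweedler (\<Delta> a) (\<lambda>a1 a2. letter (act a1 v, 0) * letter (0, a2)) + 0)"
    by (intro I0.eqv_add I0.letter_zero I0.eqv_refl)
  finally show ?thesis by simp
qed

lemma normal_form_act_word: "I0.eqv (normal_form (act_word ws a)) (letter (0, a) * V_word ws)"
proof (induction ws arbitrary: a)
  case Nil
  then show ?case using normal_form_single[of "{#}" a] by simp
next
  case (Cons w ws)
  let ?K = "Poly_Mapping.keys (\<Delta> a)" and ?l = "Poly_Mapping.lookup (\<Delta> a)"
  have "I0.eqv (normal_form (act_word (w # ws) a)) (\<Sum>x\<in>?K. normal_form (scale_poly (?l x) (iota (act (fst x) w) * act_word ws (snd x))))"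
    using normal_form_sum by (simp add: cosum_def case_prod_beta)
  also have "I0.eqv \<dots> (\<Sum>x\<in>?K. const (?l x) * (letter (act (fst x) w, 0) * (letter (0, snd x) * V_word ws)))"
  proof (rule I0.eqv_sum)
    fix x
    note normal_form_scale_poly[of "?l x" "iota (act (fst x) w) * act_word ws (snd x)"]
    also have "I0.eqv (const (?l x) * normal_form (iota (act (fst x) w) * act_word ws (snd x)))
        (const (?l x) * (letter (act (fst x) w, 0) * normal_form (act_word ws (snd x))))"
      by (intro I0.eqv_mult I0.eqv_refl normal_form_iota)
    also have "I0.eqv \<dots> (const (?l x) * (letter (act (fst x) w, 0) * (letter (0, snd x) * V_word ws)))"
      by (intro I0.eqv_mult I0.eqv_refl Cons.IH)
    finally show "I0.eqv (normal_form (scale_poly (?l x) (iota (act (fst x) w) * act_word ws (snd x))))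
        (const (?l x) * (letter (act (fst x) w, 0) * (letter (0, snd x) * V_word ws)))" .
  qed
  also have "\<dots> = sweedler (\<Delta> a) (\<lambda>a1 a2. letter (act a1 w, 0) * letter (0, a2)) * V_word ws"
    by (simp add: sweedler_def case_prod_beta sum_distrib_right mult.assoc)
  also have "I0.eqv \<dots> (letter (0, a) * letter (w, 0) * V_word ws)"
    by (intro I0.eqv_mult I0.eqv_refl I0.eqv_sym[OF letter_cross_0])
  finally show ?case by (simp add: mult.assoc)
qed

lemma normal_form_act_poly: "I0.eqv (normal_form (act_poly a q)) (letter (0, a) * normal_form q)"
proof -
  have "I0.eqv (normal_form (act_poly a q)) (letter (0, a) * normal_form q * 1)"
  proof (rule normal_form_map)
    fix M c
    have "I0.eqv (normal_form (act_poly a (Poly_Mapping.single M c))) (normal_form (act_word (listing M) a) * letter (0, c))"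
      unfolding act_poly_single by (rule normal_form_emb)
    also have "I0.eqv \<dots> ((letter (0, a) * V_word (listing M)) * letter (0, c))"
      by (intro I0.eqv_mult I0.eqv_refl normal_form_act_word)
    finally show "I0.eqv (normal_form (act_poly a (Poly_Mapping.single M c)))
        (letter (0, a) * (V_word (listing M) * letter (0, c)) * 1)"
      by (simp add: mult.assoc)
  qed (rule act_poly_add_right)
  then show ?thesis by simp
qed

text \<open>Normal forms absorb letters from the left because \<open>normal_form\<close> intertwines, modulo the
  ideal, the operators \<open>step\<close> with multiplication by letters.\<close>

lemma ex_normal_form: "\<exists>q. over_B q \<and> I0.eqv p (normal_form q)"
proof (induction p rule: freealg_induct)
  case (const c)
  have "I0.eqv (const c) (normal_form (emb (sA c 1)))"
    using I0.eqv_trans[OF I0.const_eqv_letter I0.eqv_sym[OF normal_form_single[of "{#}" "sA c 1"], simplified]] by simp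
  then show ?case using over_B_emb by blast
next
  case (letter x p)
  then obtain q where q: "over_B q" "I0.eqv p (normal_form q)" by blast
  obtain v a where x: "x = (v, a)" by (cases x)
  have "I0.eqv (letter x * p) ((letter (v, 0) + letter (0, a)) * normal_form q)"
    unfolding x by (intro I0.eqv_mult I0.letter_split q)
  also have "\<dots> = letter (v, 0) * normal_form q + letter (0, a) * normal_form q" by (rule distrib_right)
  also have "I0.eqv \<dots> (normal_form (iota v * q) + normal_form (act_poly a q))"
    by (intro I0.eqv_add I0.eqv_sym[OF normal_form_iota] I0.eqv_sym[OF normal_form_act_poly])
  also have "I0.eqv \<dots> (normal_form (step x q))"
    unfolding x step_def fst_conv snd_conv by (rule I0.eqv_sym[OF normal_form_add])
  finally show ?case using over_B_step[OF q(1)] by blast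
next
  case (add p p')
  then obtain q q' where q: "over_B q" "I0.eqv p (normal_form q)" "over_B q'" "I0.eqv p' (normal_form q')" by blast
  have "I0.eqv (p + p') (normal_form (q + q'))"
    using I0.eqv_trans[OF I0.eqv_add[OF q(2,4)] I0.eqv_sym[OF normal_form_add]] .
  then show ?case using over_B_add[OF q(1,3)] by blast
qed

lemma Phi_V_word: "set ws \<subseteq> B \<Longrightarrow> Phi (V_word ws) q = Poly_Mapping.single (mset ws) 1 * q"
proof (induction ws)
  case (Cons w ws)
  have "Phi (V_word (w # ws)) q = indet w * (Poly_Mapping.single (mset ws) 1 * q)"
    using Cons by (simp add: Phi_letter_mult step_V iota_basis)
  also have "\<dots> = (indet w * Poly_Mapping.single (mset ws) 1) * q" by (rule mult.assoc[symmetric])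
  finally show ?case by (simp add: indet_def mult_single)
qed simp

lemma Phi_normal_form:
  assumes "over_B q"
  shows "Phi (normal_form q) r = (\<Sum>M\<in>Poly_Mapping.keys q. Poly_Mapping.single M 1 * act_poly (Poly_Mapping.lookup q M) r)"
  unfolding normal_form_def coeff_sum_def Phi_sum
proof (rule sum.cong[OF refl])
  fix M assume "M \<in> Poly_Mapping.keys q"
  then have "set (listing M) \<subseteq> B"
    using assms by (metis over_B_def mset_listing set_mset_mset)
  then show "Phi (V_word (listing M) * letter (0, Poly_Mapping.lookup q M)) r =
      Poly_Mapping.single M 1 * act_poly (Poly_Mapping.lookup q M) r"
    by (simp add: Phi_mult Phi_V_word Phi_letter step_A)
qed

lemma Phi_normal_form_one: "over_B q \<Longrightarrow> Phi (normal_form q) 1 = q"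
  using act_poly_emb[of _ 1] by (simp add: Phi_normal_form mult_single sum_singles)

lemma over_B_one: "over_B 1"
  using over_B_emb[of 1] by simp

lemma eqv_normal_form_Phi: "I0.eqv p (normal_form (Phi p 1))"
proof -
  obtain q where q: "over_B q" "I0.eqv p (normal_form q)" using ex_normal_form by blast
  have "Phi (p - normal_form q) 1 = 0"
    using q(2) by (intro Phi_I0 over_B_one) (simp add: I0.eqv_def)
  then have "Phi p 1 = q" by (simp add: Phi_diff Phi_normal_form_one[OF q(1)])
  then show ?thesis using q(2) by simp
qed

text \<open>The smash product is faithfully represented by its action on \<open>1\<close>: one inclusion is the module
  property, the other holds since a normal form with vanishing polynomial is zero.\<close>

lemma mem_I0_iff: "p \<in> I0 \<longleftrightarrow> Phi p 1 = 0"
  using Phi_I0[OF _ over_B_one] eqv_normal_form_Phi[of p] by (auto simp: I0.mem_iff_eqv_zero)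

text \<open>The smash product on the model: \<open>p\<close> acts like the normal form with the same polynomial.\<close>

lemma Phi_apply:
  assumes "over_B r"
  shows "Phi p r = (\<Sum>M\<in>Poly_Mapping.keys (Phi p 1).
    Poly_Mapping.single M 1 * act_poly (Poly_Mapping.lookup (Phi p 1) M) r)"
proof -
  have "Phi (p - normal_form (Phi p 1)) r = 0"
    using eqv_normal_form_Phi by (intro Phi_I0 assms) (simp add: I0.eqv_def)
  then show ?thesis by (simp add: Phi_diff Phi_normal_form over_B_Phi over_B_one)
qed

end

section \<open>Homogeneous elements\<close>

text \<open>A letter \<open>(v, a)\<close> with both entries nonzero is not homogeneous. Elements here are built from pure letters, so
  that the value of the PBW isomorphism on them is forced by its values on generators.\<close>

inductive homog :: "nat \<Rightarrow> ('v::zero \<times> 'a::zero, 'k::field) freealg \<Rightarrow> bool" where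
  homog_zero: "homog n 0"
| homog_const: "homog 0 (const c)"
| homog_A: "homog 0 (letter (0, a))"
| homog_V: "homog 1 (letter (v, 0))"
| homog_add: "homog n p \<Longrightarrow> homog n q \<Longrightarrow> homog n (p + q)"
| homog_mult: "homog m p \<Longrightarrow> homog n q \<Longrightarrow> homog (m + n) (p * q)"

lemma homog_diff:
  assumes "homog n p" "homog n q"
  shows "homog n (p - q)"
proof -
  have "homog n (const (- 1) * q)"
    using homog_mult[OF homog_const assms(2)] by simp
  from homog_add[OF assms(1) this] show ?thesis
    by (simp add: const_simps)
qed

lemma (in structure_relations) homog_0_eqv_letter:
  assumes "homog n p" "n = 0"
  shows "\<exists>a. eqv p (letter (0, a))"
  using assms
proof (induction rule: homog.induct)
  case (homog_zero n)
  then show ?case using eqv_sym[OF letter_zero] by blast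
next
  case (homog_const c)
  then show ?case using const_eqv_letter by blast
next
  case (homog_A a)
  then show ?case using eqv_refl by blast
next
  case (homog_add n p q)
  then obtain a b where "eqv p (letter (0, a))" "eqv q (letter (0, b))" by blast
  then have "eqv (p + q) (letter (0, a + b))"
    by (meson eqv_add eqv_sym eqv_trans letter_A_add)
  then show ?case by blast
next
  case (homog_mult m p n q)
  then obtain a b where "eqv p (letter (0, a))" "eqv q (letter (0, b))" by auto
  then have "eqv (p * q) (letter (0, a * b))"
    by (meson eqv_mult eqv_trans letter_A_mult)
  then show ?case by blast
qed simp

section \<open>Homogeneous central elements of the smash product\<close>

context smash_model
begin

lemma lookup_emb_right: "Poly_Mapping.lookup (q * emb c) M = Poly_Mapping.lookup q M * c"
  by (induction q rule: poly_mapping_additive_induct)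
     (simp_all add: mult_single lookup_single when_def distrib_right lookup_add)

lemma lookup_indet_mult: "Poly_Mapping.lookup (indet b * q) (add_mset b M) = Poly_Mapping.lookup q M"
  by (induction q rule: poly_mapping_additive_induct)
     (simp_all add: indet_def mult_single lookup_single when_def distrib_left lookup_add)

definition no_const :: "('v multiset \<Rightarrow>\<^sub>0 'a) \<Rightarrow> bool"
  where "no_const q \<longleftrightarrow> Poly_Mapping.lookup q {#} = 0"

lemma no_const_add: "no_const p \<Longrightarrow> no_const q \<Longrightarrow> no_const (p + q)"
  by (simp add: no_const_def lookup_add)

lemma no_const_zero [simp]: "no_const 0"
  by (simp add: no_const_def)

lemma no_const_sum: "(\<And>x. x \<in> K \<Longrightarrow> no_const (f x)) \<Longrightarrow> no_const (sum f K)"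
  by (simp add: no_const_def lookup_sum)

lemma no_const_emb: "no_const q \<Longrightarrow> no_const (q * emb c)"
  by (simp add: no_const_def lookup_emb_right)

lemma no_const_scale_poly: "no_const q \<Longrightarrow> no_const (scale_poly c q)"
  unfolding scale_poly_commute by (rule no_const_emb)

lemma no_const_iota: "no_const (iota w * q)"
proof -
  have "no_const (indet b * q)" for b
    by (induction q rule: poly_mapping_additive_induct)
       (simp_all add: indet_def mult_single distrib_left no_const_add,
        simp add: no_const_def lookup_single when_def)
  then show ?thesis
    by (simp add: iota_def sum_distrib_right scale_poly_mult_left no_const_sum no_const_scale_poly)
qed

lemma no_const_act_word: "ws \<noteq> [] \<Longrightarrow> no_const (act_word ws a)"
  by (cases ws) (auto simp: cosum_def case_prod_beta intro!: no_const_sum no_const_scale_poly no_const_iota)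

lemma no_const_act_poly:
  assumes "no_const q"
  shows "no_const (act_poly a q)"
  unfolding act_poly_def coeff_sum_def
proof (intro no_const_sum no_const_emb no_const_act_word notI)
  fix M assume "M \<in> Poly_Mapping.keys q" "listing M = []"
  then have "Poly_Mapping.lookup q {#} \<noteq> 0"
    by (metis in_keys_iff mset.simps(1) mset_listing)
  then show False using assms by (simp add: no_const_def)
qed

text \<open>Positive degree enters the model as the absence of the empty monomial, the only one on which
  \<open>A\<close> acts by plain multiplication.\<close>

lemma homog_Phi_no_const:
  assumes "homog n p" "no_const q \<or> n > 0"
  shows "no_const (Phi p q)"
  using assms
proof (induction arbitrary: q rule: homog.induct)
  case (homog_const c)
  then show ?case using Phi_const[of c 1] by (simp add: no_const_scale_poly)
next
  case (homog_A a)
  then show ?case by (simp add: Phi_letter step_A no_const_act_poly)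
next
  case (homog_V v)
  then show ?case by (simp add: Phi_letter step_V no_const_iota)
next
  case (homog_mult m p n r)
  then show ?case by (auto simp: Phi_mult)
qed (auto simp: Phi_add intro: no_const_add)

text \<open>Compare the coefficients of \<open>v\<^sub>0 M\<close> in \<open>v\<^sub>0 p\<close> and \<open>p v\<^sub>0\<close>. On the left it is the full coefficient
  of \<open>M\<close>; on the right only its scalar part, as the part \<open>x\<close> in \<open>U\<close> gives \<open>\<Sum> x\<^sub>1(v\<^sub>0) x\<^sub>2 = 0\<close>. It
  is convenient that \<open>v\<^sub>0\<close> is itself a variable.\<close>

lemma scalar_coefficients:
  assumes v0: "v0 \<in> B" "\<And>x. x \<in> U \<Longrightarrow> act x v0 = 0"
    and decomp: "\<And>a. \<exists>x\<in>U. \<exists>c. a = x + sA c 1"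
    and coproduct_U: "\<And>a. a \<in> U \<Longrightarrow> in_tensor_square sA U (\<Delta> a)"
    and commute: "letter (v0, 0) * p - p * letter (v0, 0) \<in> I0"
  shows "\<exists>\<alpha>. Poly_Mapping.lookup (Phi p 1) M = sA \<alpha> 1"
proof -
  let ?\<eta> = "Phi p 1"
  let ?c = "\<lambda>M. Poly_Mapping.lookup ?\<eta> M"
  have "\<forall>M. \<exists>x \<alpha>. x \<in> U \<and> ?c M = x + sA \<alpha> 1"
    using decomp by metis
  then obtain x \<alpha> where x\<alpha>: "\<And>M. x M \<in> U" "\<And>M. ?c M = x M + sA (\<alpha> M) 1" by metis
  have "act_poly (x M) (indet v0) = 0" for M
  proof -
    have "act_poly (x M) (indet v0) = cosum (x M) (\<lambda>a b. iota (act a v0) * act_poly b 1)"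
      using act_poly_iota_basis[OF v0(1), of "x M" 1] by simp
    also have "\<dots> = 0"
      by (rule cosum_vanishes[OF coproduct_U[OF x\<alpha>(1)] bilin_iota_act_poly]) (simp add: v0(2))
    finally show ?thesis .
  qed
  moreover have "act_poly 1 (indet v0) = indet v0"
    unfolding iota_basis[OF v0(1), symmetric] by (rule act_poly_one[OF over_B_iota])
  ultimately have "act_poly (?c M) (indet v0) = Poly_Mapping.single {#v0#} (sA (\<alpha> M) 1)" for M
    by (simp add: x\<alpha>(2) act_poly_linear scale_poly_single indet_def)
  then have "Phi p (indet v0) =
      (\<Sum>M'\<in>Poly_Mapping.keys ?\<eta>. Poly_Mapping.single (add_mset v0 M') (sA (\<alpha> M') 1))"
    using over_B_iota[of v0]
    by (subst Phi_apply) (simp_all add: iota_basis[OF v0(1)] mult_single)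
  moreover have "indet v0 * ?\<eta> = Phi p (indet v0)"
    using commute unfolding mem_I0_iff
    by (simp add: Phi_diff Phi_letter_mult Phi_mult Phi_letter step_V iota_basis[OF v0(1)])
  ultimately have "?c M = (\<Sum>M'\<in>Poly_Mapping.keys ?\<eta>. sA (\<alpha> M') 1 when M' = M)"
    using lookup_indet_mult[of v0 ?\<eta> M]
    by (simp add: lookup_sum lookup_single when_def)
  then have "?c M = (if M \<in> Poly_Mapping.keys ?\<eta> then sA (\<alpha> M) 1 else 0)"
    by (simp add: when_def sum.delta')
  then show ?thesis
    by (metis scale_zero_left)
qed

text \<open>The map \<open>id \<otimes> \<phi>\<close> from \<open>Sym(V) \<otimes> A\<close> to \<open>Sym(V)\<close>, with \<open>Sym(V)\<close> embedded as the polynomials with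
  scalar coefficients.\<close>

definition coeff_map :: "('a \<Rightarrow> 'k) \<Rightarrow> ('v multiset \<Rightarrow>\<^sub>0 'a) \<Rightarrow> ('v multiset \<Rightarrow>\<^sub>0 'a)"
  where "coeff_map \<phi> = coeff_sum (\<lambda>M c. Poly_Mapping.single M (sA (\<phi> c) 1))"

context
  fixes \<phi> :: "'a \<Rightarrow> 'k"
  assumes \<phi>_add: "\<And>a b. \<phi> (a + b) = \<phi> a + \<phi> b" and \<phi>_scale: "\<And>c a. \<phi> (sA c a) = c * \<phi> a"
begin

lemma coeff_map_add: "coeff_map \<phi> (p + q) = coeff_map \<phi> p + coeff_map \<phi> q"
  unfolding coeff_map_def by (rule coeff_sum_add) (simp add: \<phi>_add scale_left_distrib single_add)

lemma coeff_map_single: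
  "coeff_map \<phi> (Poly_Mapping.single M c) = Poly_Mapping.single M (sA (\<phi> c) 1)"
  unfolding coeff_map_def using \<phi>_scale[of 0 0] by (intro coeff_sum_single) simp

lemma coeff_map_zero: "coeff_map \<phi> 0 = 0"
  by (simp add: coeff_map_def)

lemma coeff_map_sum: "coeff_map \<phi> (sum f K) = (\<Sum>x\<in>K. coeff_map \<phi> (f x))"
  by (induction K rule: infinite_finite_induct) (simp_all add: coeff_map_zero coeff_map_add)

lemma coeff_map_scale_poly: "coeff_map \<phi> (scale_poly c q) = scale_poly c (coeff_map \<phi> q)"
  by (induction q rule: poly_mapping_additive_induct)
     (simp_all add: scale_poly_single coeff_map_single \<phi>_scale M.scale_right_distrib coeff_map_add)

lemma coeff_map_indet: "coeff_map \<phi> (indet b * q) = indet b * coeff_map \<phi> q"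
  by (induction q rule: poly_mapping_additive_induct)
     (simp_all add: indet_def mult_single coeff_map_single distrib_left coeff_map_add)

lemma coeff_map_iota: "coeff_map \<phi> (iota w * q) = iota w * coeff_map \<phi> q"
  by (simp add: iota_def sum_distrib_right scale_poly_mult_left coeff_map_sum coeff_map_scale_poly coeff_map_indet)

text \<open>The set \<open>K\<close> contains the first legs of \<open>\<Delta>(x)\<close> in the sense that \<open>\<Delta>(x) \<in> span K \<otimes> A\<close>, expressed dually as in
  \<open>cosum_vanishes\<close>. The first vector \<open>w\<close> of the word turns into \<open>y\<^sub>1(x\<^sub>1(w)) = (y\<^sub>1 x\<^sub>1)(w)\<close>, and
  \<open>y\<^sub>1 x\<^sub>1 = 0\<close>. An empty word would leave no vector for \<open>x\<^sub>1\<close> to act on.\<close>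

lemma act_poly_coeff_map_act_word:
  assumes y: "in_tensor_square sA U (\<Delta> y)"
    and x: "\<And>\<beta>. bilin sA scale_poly \<beta> \<Longrightarrow> (\<And>a b. a \<in> K \<Longrightarrow> \<beta> a b = 0) \<Longrightarrow> cosum x \<beta> = 0"
    and ann: "\<And>u a. u \<in> U \<Longrightarrow> a \<in> K \<Longrightarrow> u * a = 0"
    and "ws \<noteq> []"
  shows "act_poly y (coeff_map \<phi> (act_word ws x)) = 0"
proof -
  obtain w ws' where ws: "ws = w # ws'" using assms(4) by (cases ws) auto
  let ?\<beta> = "\<lambda>a b y1 y2. iota (act y1 (act a w)) * act_poly y2 (coeff_map \<phi> (act_word ws' b))"
  have "coeff_map \<phi> (act_word ws x) = cosum x (\<lambda>a b. iota (act a w) * coeff_map \<phi> (act_word ws' b))"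
    unfolding ws by (simp add: cosum_map[of "coeff_map \<phi>"] coeff_map_add coeff_map_scale_poly coeff_map_iota)
  then have "act_poly y (coeff_map \<phi> (act_word ws x)) = cosum x (\<lambda>a b. cosum y (?\<beta> a b))"
    by (simp add: act_poly_cosum act_poly_iota)
  also have "\<dots> = 0"
  proof (rule x)
    show "bilin sA scale_poly (\<lambda>a b. cosum y (?\<beta> a b))"
      by (rule bilin_cosum, rule bilinI)
         (simp_all add: act_simps iota_add iota_scale distrib_left distrib_right scale_poly_mult_left scale_poly_mult_right
            act_word_linear coeff_map_add coeff_map_scale_poly act_poly_add_right act_poly_scale_poly)
    fix a b assume a: "a \<in> K"
    show "cosum y (?\<beta> a b) = 0"
    proof (rule cosum_vanishes[OF y bilin_iota_act_poly])
      fix u c assume "u \<in> U"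
      then have "act u (act a w) = 0"
        using ann[OF _ a, of u] by (simp flip: act_simps(6))
      then show "?\<beta> a b u c = 0" by simp
    qed
  qed
  finally show ?thesis .
qed

end

text \<open>Applying \<open>id \<otimes> \<phi>\<close> with \<open>\<phi>(x) = 1\<close> to \<open>x \<eta> = \<eta> x\<close> expresses \<open>\<eta>\<close> by polynomials that
  \<open>x\<close> annihilates. So \<open>\<eta> x = x \<eta> = 0\<close>, and the coefficients of \<open>\<eta>\<close> are scalars.\<close>

lemma scalar_commuting_eq_zero:
  assumes scalars: "\<And>M. \<exists>\<alpha>. Poly_Mapping.lookup \<eta> M = sA \<alpha> 1"
    and no_const: "no_const \<eta>"
    and commute: "act_poly x \<eta> = \<eta> * emb x"
    and "x \<noteq> 0" and x: "in_tensor_square sA U (\<Delta> x)"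
    and K: "\<And>\<beta>. bilin sA scale_poly \<beta> \<Longrightarrow> (\<And>a b. a \<in> K \<Longrightarrow> \<beta> a b = 0) \<Longrightarrow> cosum x \<beta> = 0"
    and ann: "\<And>u a. u \<in> U \<Longrightarrow> a \<in> K \<Longrightarrow> u * a = 0"
  shows "\<eta> = 0"
proof -
  define C where "C = extend_basis {x}"
  define \<phi> where "\<phi> = (\<lambda>a. representation C a x)"
  have C: "independent C" "span C = UNIV" "x \<in> C"
    using extend_basis_superset[of "{x}"] independent_extend_basis[of "{x}"] span_extend_basis[of "{x}"]
      \<open>x \<noteq> 0\<close> by (auto simp: C_def)
  have \<phi>: "\<phi> (a + b) = \<phi> a + \<phi> b" "\<phi> (sA c a) = c * \<phi> a" for a b c
    using representation_add[OF C(1), of b a] representation_scale[OF C(1), of a c] C(2)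
    by (simp_all add: \<phi>_def add.commute)
  have \<phi>x: "\<phi> x = 1"
    using representation_basis[OF C(1,3)] by (simp add: \<phi>_def)
  obtain \<alpha> where \<alpha>: "\<And>M. Poly_Mapping.lookup \<eta> M = sA (\<alpha> M) 1" using scalars by metis
  let ?K = "Poly_Mapping.keys \<eta>"
  have \<eta>: "\<eta> = (\<Sum>M\<in>?K. Poly_Mapping.single M (sA (\<alpha> M) 1))"
    using sum_singles[of \<eta>] by (simp add: \<alpha>)
  have "\<eta> * emb x = (\<Sum>M\<in>?K. Poly_Mapping.single M (sA (\<alpha> M) x))"
    by (subst \<eta>) (simp add: sum_distrib_right mult_single scale_mult_left)
  then have "coeff_map \<phi> (\<eta> * emb x) = \<eta>"
    by (subst \<eta>) (simp add: coeff_map_sum[OF \<phi>] coeff_map_single[OF \<phi>] \<phi> \<phi>x)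
  moreover have "act_poly x \<eta> = (\<Sum>M\<in>?K. scale_poly (\<alpha> M) (act_word (listing M) x))"
    by (simp add: act_poly_def coeff_sum_def \<alpha> scale_poly_commute)
  ultimately have "\<eta> = (\<Sum>M\<in>?K. scale_poly (\<alpha> M) (coeff_map \<phi> (act_word (listing M) x)))"
    using commute by (simp add: coeff_map_sum[OF \<phi>] coeff_map_scale_poly[OF \<phi>])
  then have "act_poly x \<eta> = act_poly x (\<Sum>M\<in>?K. scale_poly (\<alpha> M) (coeff_map \<phi> (act_word (listing M) x)))"
    by simp
  also have "\<dots> = (\<Sum>M\<in>?K. scale_poly (\<alpha> M) (act_poly x (coeff_map \<phi> (act_word (listing M) x))))"
  proof -
    have "act_poly x (sum f L) = (\<Sum>M\<in>L. act_poly x (f M))" for f and L :: "'v multiset set"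
      by (induction L rule: infinite_finite_induct) (simp_all add: act_poly_add_right)
    then show ?thesis by (simp add: act_poly_scale_poly)
  qed
  also have "\<dots> = 0"
  proof (rule sum.neutral, rule ballI)
    fix M assume "M \<in> ?K"
    then have "listing M \<noteq> []"
      using no_const by (metis in_keys_iff mset.simps(1) mset_listing no_const_def)
    have "act_poly x (coeff_map \<phi> (act_word (listing M) x)) = 0"
    proof (rule act_poly_coeff_map_act_word[OF \<phi> x, where K = K])
      show "cosum x \<beta> = 0" if "bilin sA scale_poly \<beta>" "\<And>a b. a \<in> K \<Longrightarrow> \<beta> a b = 0" for \<beta>
        by (rule K[OF that])
      show "u * a = 0" if "u \<in> U" "a \<in> K" for u a
        by (rule ann[OF that])
    qed fact
    then show "scale_poly (\<alpha> M) (act_poly x (coeff_map \<phi> (act_word (listing M) x))) = 0"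
      by simp
  qed
  finally have "\<eta> * emb x = 0" using commute by simp
  then have "sA (\<alpha> M) x = 0" for M
    using lookup_emb_right[of \<eta> x M] by (simp add: \<alpha> scale_mult_left)
  then have "\<alpha> M = 0" for M using \<open>x \<noteq> 0\<close> by simp
  then show ?thesis by (intro poly_mapping_eqI) (simp add: \<alpha>)
qed

text \<open>The coproduct of a product of \<open>n\<close> elements of \<open>U\<close> has first legs that are combinations of products of \<open>n\<close>
  elements of \<open>U\<close>, since \<open>\<Delta>\<close> is multiplicative. The claim is its dual form.\<close>

lemma cosum_prod_list_vanishes:
  assumes "\<And>a. a \<in> U \<Longrightarrow> in_tensor_square sA U (\<Delta> a)" "set xs \<subseteq> U" "xs \<noteq> []"
    and "bilin sA scale_poly \<beta>"
    and "\<And>ys b. length ys = length xs \<Longrightarrow> set ys \<subseteq> U \<Longrightarrow> \<beta> (prod_list ys) b = 0"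
  shows "cosum (prod_list xs) \<beta> = 0"
  using assms(2-)
proof (induction xs arbitrary: \<beta>)
  case (Cons x xs)
  note b = bilinD[OF Cons.prems(3)]
  show ?case
  proof (cases "xs = []")
    case True
    have "cosum x \<beta> = 0"
    proof (rule cosum_vanishes[OF assms(1) Cons.prems(3)])
      fix a c assume "a \<in> U"
      then show "\<beta> a c = 0" using Cons.prems(4)[of "[a]" c] True by simp
    qed (use Cons.prems in simp)
    then show ?thesis using True by simp
  next
    case False
    have "cosum (x * prod_list xs) \<beta> = cosum x (\<lambda>a1 a2. cosum (prod_list xs) (\<lambda>b1 b2. \<beta> (a1 * b1) (a2 * b2)))"
      by (rule cosum_mult[OF Cons.prems(3)])
    also have "\<dots> = 0"
    proof (rule cosum_vanishes[OF assms(1)])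
      show "x \<in> U" using Cons.prems by simp
      show "bilin sA scale_poly (\<lambda>a1 a2. cosum (prod_list xs) (\<lambda>b1 b2. \<beta> (a1 * b1) (a2 * b2)))"
        by (rule bilin_cosum, rule bilinI) (simp_all add: distrib_right b scale_mult_left)
      fix a1 a2 assume a: "a1 \<in> U"
      show "cosum (prod_list xs) (\<lambda>b1 b2. \<beta> (a1 * b1) (a2 * b2)) = 0"
      proof (rule Cons.IH)
        show "bilin sA scale_poly (\<lambda>b1 b2. \<beta> (a1 * b1) (a2 * b2))"
          by (rule bilinI) (simp_all add: distrib_left b scale_mult_right)
        fix ys c assume "length ys = length xs" "set ys \<subseteq> U"
        then show "\<beta> (a1 * prod_list ys) (a2 * c) = 0"
          using Cons.prems(4)[of "a1 # ys" "a2 * c"] a by simp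
      qed (use Cons.prems False in auto)
    qed
    finally show ?thesis by simp
  qed
qed simp

text \<open>The hypotheses on \<open>v0\<close> and \<open>xs\<close> describe what nilpotency provides: a vector killed by
  \<open>U\<close>, and a longest nonzero product of elements of \<open>U\<close>.\<close>

lemma homog_central:
  assumes v0: "v0 \<in> B" "\<And>x. x \<in> U \<Longrightarrow> act x v0 = 0"
    and decomp: "\<And>a. \<exists>x\<in>U. \<exists>c. a = x + sA c 1"
    and coproduct_U: "\<And>a. a \<in> U \<Longrightarrow> in_tensor_square sA U (\<Delta> a)"
    and xs: "set xs \<subseteq> U" "xs \<noteq> []" "prod_list xs \<noteq> 0" "prod_list xs \<in> U"
    and ann: "\<And>ys. set ys \<subseteq> U \<Longrightarrow> length ys = Suc (length xs) \<Longrightarrow> prod_list ys = 0"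
    and p: "homog n p"
    and commute: "\<And>x. letter x * p - p * letter x \<in> I0"
  shows "\<exists>c. p - const c \<in> I0" and "n > 0 \<Longrightarrow> p \<in> I0"
proof -
  note scalars = scalar_coefficients[OF v0 decomp coproduct_U commute]
  show "p \<in> I0" if "n > 0"
    unfolding mem_I0_iff
  proof (rule scalar_commuting_eq_zero[OF scalars])
    show "no_const (Phi p 1)" using homog_Phi_no_const[OF p] that by simp
    have "Phi (letter (0, prod_list xs) * p - p * letter (0, prod_list xs)) 1 = 0"
      using commute mem_I0_iff by blast
    then have "act_poly (prod_list xs) (Phi p 1) = Phi p (act_poly (prod_list xs) 1)"
      by (simp add: Phi_diff Phi_letter_mult Phi_mult Phi_letter step_A)
    also have "\<dots> = Phi p 1 * emb (prod_list xs)"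
      using Phi_right_linear(2)[of p 1 "prod_list xs"] act_poly_emb[of "prod_list xs" 1] by simp
    finally show "act_poly (prod_list xs) (Phi p 1) = Phi p 1 * emb (prod_list xs)" .
    let ?K = "{prod_list ys | ys. length ys = length xs \<and> set ys \<subseteq> U}"
    show "cosum (prod_list xs) \<beta> = 0"
      if "bilin sA scale_poly \<beta>" "\<And>a b. a \<in> ?K \<Longrightarrow> \<beta> a b = 0" for \<beta>
      by (rule cosum_prod_list_vanishes[OF coproduct_U xs(1,2) that(1)]) (use that(2) in blast)+
    show "u * a = 0" if u: "u \<in> U" and a: "a \<in> ?K" for u a
    proof -
      obtain ys where "a = prod_list ys" "length ys = length xs" "set ys \<subseteq> U" using a by blast
      then show ?thesis using ann[of "u # ys"] u by simp
    qed
  qed (use xs coproduct_U in auto)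
  show "\<exists>c. p - const c \<in> I0"
  proof (cases "n = 0")
    case True
    then obtain a where a: "I0.eqv p (letter (0, a))"
      using I0.homog_0_eqv_letter[OF p] by blast
    then have "Phi (p - letter (0, a)) 1 = 0"
      by (simp add: I0.eqv_def mem_I0_iff)
    then have "Phi p 1 = emb a"
      using act_poly_emb[of a 1] by (simp add: Phi_diff Phi_letter step_A)
    then obtain c where "a = sA c 1"
      using scalars[of "{#}"] by auto
    then have "I0.eqv p (const c)"
      using I0.eqv_trans[OF a] I0.eqv_sym[OF I0.const_eqv_letter] by simp
    then show ?thesis by (auto simp: I0.eqv_def)
  next
    case False
    then show ?thesis
      using \<open>n > 0 \<Longrightarrow> p \<in> I0\<close> by (intro exI[of _ 0]) (simp add: const_simps)
  qed
qed

end

section \<open>Associated graded rings\<close>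

locale filtered_ring = ring R for R (structure) +
  fixes F :: "nat \<Rightarrow> 'a set"
  assumes F_subgroup: "additive_subgroup (F n) R"
    and F_Suc: "F n \<subseteq> F (Suc n)"
    and F_mult: "x \<in> F m \<Longrightarrow> y \<in> F n \<Longrightarrow> x \<otimes> y \<in> F (m + n)"
begin

abbreviation "L \<equiv> filt_pred R F"

lemma L_subgroup: "additive_subgroup (L n) R"
proof (cases n)
  case 0
  then show ?thesis
    using ideal.axioms(1)[OF zeroideal] by (simp add: filt_pred_def)
qed (simp add: filt_pred_def F_subgroup)

lemma L_abelian_subgroup: "abelian_subgroup (L n) R"
  by (rule abelian_subgroupI3[OF L_subgroup is_abelian_group])

lemmas F_zero = additive_subgroup.zero_closed[OF F_subgroup]
lemmas L_zero = additive_subgroup.zero_closed[OF L_subgroup]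
lemmas L_add = additive_subgroup.a_closed[OF L_subgroup]
lemmas F_carrier = additive_subgroup.a_Hcarr[OF F_subgroup]
lemmas L_carrier = additive_subgroup.a_Hcarr[OF L_subgroup]

lemma L_subset_F: "L n \<subseteq> F n"
  using F_zero F_Suc by (auto simp: filt_pred_def split: nat.splits)

lemma L_mult:
  "x \<in> L m \<Longrightarrow> y \<in> F n \<Longrightarrow> x \<otimes> y \<in> L (m + n)"
  "x \<in> F m \<Longrightarrow> y \<in> L n \<Longrightarrow> x \<otimes> y \<in> L (m + n)"
proof -
  show "x \<otimes> y \<in> L (m + n)" if "x \<in> L m" "y \<in> F n"
  proof (cases m)
    case 0
    then show ?thesis using that F_carrier[OF that(2)] L_zero by (simp add: filt_pred_def)
  next
    case (Suc k)
    then show ?thesis using that F_mult[of x k y n] by (simp add: filt_pred_def)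
  qed
  show "x \<otimes> y \<in> L (m + n)" if "x \<in> F m" "y \<in> L n"
  proof (cases n)
    case 0
    then show ?thesis using that F_carrier[OF that(1)] L_zero[of m] by (simp add: filt_pred_def)
  next
    case (Suc k)
    then show ?thesis using that F_mult[of x m y k] by (simp add: filt_pred_def)
  qed
qed

lemma L_coset_eq_iff:
  assumes "x \<in> carrier R" "y \<in> carrier R"
  shows "L n +> x = L n +> y \<longleftrightarrow> x \<ominus> y \<in> L n"
  using abelian_subgroup.a_rcos_module_minus[OF L_abelian_subgroup ring_axioms assms(2,1), of n]
    abelian_subgroup.a_repr_independence'[OF L_abelian_subgroup, of x n y]
    abelian_subgroup.a_repr_independenceD[OF L_abelian_subgroup, of x n y] assms
    abelian_subgroup.a_rcos_self[OF L_abelian_subgroup, of x n]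
  by auto

lemma L_coset_zero: "L n +> \<zero> = L n"
  using abelian_group.a_coset_add_zero[OF is_abelian_group] L_carrier by blast

lemma graded_elem_apply: "graded_elem R F n y k = L k +> (if k = n then y else \<zero>)"
  by (simp add: graded_elem_def L_coset_zero)

lemma graded_elem_eq_zero_iff:
  assumes "y \<in> carrier R"
  shows "graded_elem R F n y = \<zero>\<^bsub>assoc_graded R F\<^esub> \<longleftrightarrow> y \<in> L n"
proof -
  have "graded_elem R F n y = \<zero>\<^bsub>assoc_graded R F\<^esub> \<longleftrightarrow> L n +> y = L n +> \<zero>"
    by (auto simp: graded_elem_def assoc_graded_def L_coset_zero fun_eq_iff)
  also have "\<dots> \<longleftrightarrow> y \<in> L n"
    using assms by (simp add: L_coset_eq_iff a_minus_def)
  finally show ?thesis .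
qed

lemma graded_elem_add:
  assumes "x \<in> carrier R" "y \<in> carrier R"
  shows "graded_elem R F n x \<oplus>\<^bsub>assoc_graded R F\<^esub> graded_elem R F n y = graded_elem R F n (x \<oplus> y)"
  using assms
  by (auto simp: assoc_graded_def graded_elem_apply fun_eq_iff
      abelian_subgroup.a_rcos_sum[OF L_abelian_subgroup])

lemma finsum_mod_L:
  assumes "finite A" "\<And>i. i \<in> A \<Longrightarrow> f i \<in> carrier R" "\<And>i. i \<in> A \<Longrightarrow> g i \<in> carrier R"
    and "\<And>i. i \<in> A \<Longrightarrow> f i \<ominus> g i \<in> L n"
  shows "finsum R f A \<ominus> finsum R g A \<in> L n"
  using assms
proof (induction A)
  case empty
  then show ?case by (simp add: a_minus_def L_zero)
next
  case (insert i A)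
  have c: "f i \<in> carrier R" "g i \<in> carrier R" "finsum R f A \<in> carrier R" "finsum R g A \<in> carrier R"
    using insert.prems by (auto intro!: finsum_closed)
  have "finsum R f (insert i A) \<ominus> finsum R g (insert i A) =
      (f i \<ominus> g i) \<oplus> (finsum R f A \<ominus> finsum R g A)"
    using insert.hyps insert.prems c by (simp add: finsum_insert Pi_iff a_minus_def minus_add a_ac)
  then show ?case
    using insert by (simp add: L_add)
qed

lemma singleton_of_subset: "z \<in> S \<Longrightarrow> S \<subseteq> {t} \<Longrightarrow> S = {t}"
  by blast

text \<open>The product in \<^const>\<open>assoc_graded\<close> ranges over all representatives. Changing the factors
  within their cosets changes each summand by an element of the next lower filtration step, so all
  choices give the coset of the sum for \<open>x\<close> and \<open>y\<close> themselves, in which at most one summand survives.\<close>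

lemma graded_elem_mult:
  assumes x: "x \<in> F m" and y: "y \<in> F n"
  shows "graded_elem R F m x \<otimes>\<^bsub>assoc_graded R F\<^esub> graded_elem R F n y = graded_elem R F (m + n) (x \<otimes> y)"
proof
  fix k
  let ?x = "\<lambda>i. if i = m then x else \<zero>" and ?y = "\<lambda>i. if i = n then y else \<zero>"
  let ?t = "if k = m + n then x \<otimes> y else \<zero>"
  let ?s = "\<lambda>a b. \<Oplus>i\<in>{..k}. a i \<otimes> b (k - i)"
  have xF: "?x i \<in> F i" and yF: "?y i \<in> F i" for i
    using x y F_zero by auto
  have t: "?t \<in> carrier R" using F_carrier[OF x] F_carrier[OF y] by simp
  have self: "z \<in> L i +> z" if "z \<in> carrier R" for z i
    using abelian_subgroup.a_rcos_self[OF L_abelian_subgroup that] .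
  have coset: "L k +> ?s a b = L k +> ?t"
    if a: "\<forall>i\<le>k. a i \<in> L i +> ?x i" and b: "\<forall>i\<le>k. b i \<in> L i +> ?y i" for a b
  proof -
    have fac: "\<exists>p\<in>L i. z = p \<oplus> w" if "z \<in> L i +> w" for z w i
      using that by (auto simp: a_r_coset_def')
    have aC: "a i \<in> F i" if i: "i \<le> k" for i
    proof -
      obtain p where "p \<in> L i" "a i = p \<oplus> ?x i" using fac[OF a[rule_format, OF i]] by blast
      then show ?thesis
        using L_subset_F[of i] xF[of i] additive_subgroup.a_closed[OF F_subgroup, of p i] by auto
    qed
    have bC: "b i \<in> F i" if i: "i \<le> k" for i
    proof -
      obtain p where "p \<in> L i" "b i = p \<oplus> ?y i" using fac[OF b[rule_format, OF i]] by blast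
      then show ?thesis
        using L_subset_F[of i] yF[of i] additive_subgroup.a_closed[OF F_subgroup, of p i] by auto
    qed
    have diff: "a i \<otimes> b (k - i) \<ominus> ?x i \<otimes> ?y (k - i) \<in> L k" if i: "i \<in> {..k}" for i
    proof -
      let ?j = "k - i"
      have j: "i \<le> k" "?j \<le> k" "i + ?j = k" using i by auto
      obtain p where p: "p \<in> L i" "a i = p \<oplus> ?x i"
        using fac[OF a[rule_format, OF j(1)]] by blast
      obtain q where q: "q \<in> L ?j" "b ?j = q \<oplus> ?y ?j"
        using fac[OF b[rule_format, OF j(2)]] by blast
      define u where "u = ?x i"
      define w where "w = ?y ?j"
      have c: "p \<in> carrier R" "q \<in> carrier R" "u \<in> carrier R" "w \<in> carrier R" "b ?j \<in> carrier R"
        using L_carrier p(1) q(1) F_carrier[OF xF] F_carrier[OF yF] F_carrier[OF bC[OF j(2)]]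
        by (auto simp: u_def w_def)
      have "p \<otimes> b ?j \<in> L k" "u \<otimes> q \<in> L k"
        using L_mult(1)[OF p(1) bC[OF j(2)]] L_mult(2)[OF xF q(1), of i] j(3) by (simp_all add: u_def)
      then have "p \<otimes> b ?j \<oplus> u \<otimes> q \<in> L k" by (rule L_add)
      also have "p \<otimes> b ?j \<oplus> u \<otimes> q = (p \<oplus> u) \<otimes> b ?j \<ominus> u \<otimes> w"
        using c(1-4) unfolding q(2) w_def[symmetric] by algebra
      finally show ?thesis using p(2) by (simp add: u_def w_def)
    qed
    have "?s a b \<ominus> (\<Oplus>i\<in>{..k}. ?x i \<otimes> ?y (k - i)) \<in> L k"
      using F_carrier[OF aC] F_carrier[OF bC] F_carrier[OF xF] F_carrier[OF yF]
      by (intro finsum_mod_L diff) auto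
    moreover have "(\<Oplus>i\<in>{..k}. ?x i \<otimes> ?y (k - i)) = ?t"
    proof -
      have "(\<Oplus>i\<in>{..k}. ?x i \<otimes> ?y (k - i)) = (\<Oplus>i\<in>{..k}. if m = i then ?t else \<zero>)"
        using F_carrier[OF x] F_carrier[OF y] by (intro finsum_cong') auto
      also have "\<dots> = ?t"
      proof (cases "m \<le> k")
        case True
        then show ?thesis using t by (subst add.finprod_singleton) auto
      next
        case False
        then have "(\<Oplus>i\<in>{..k}. if m = i then ?t else \<zero>) = (\<Oplus>i\<in>{..k}. \<zero>)"
          by (intro finsum_cong') auto
        then show ?thesis using False by simp
      qed
      finally show ?thesis .
    qed
    moreover have "?s a b \<in> carrier R"
      using F_carrier[OF aC] F_carrier[OF bC] by (intro finsum_closed) auto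
    ultimately show ?thesis using t by (simp add: L_coset_eq_iff)
  qed
  let ?S = "{L k +> ?s a b | a b. (\<forall>i\<le>k. a i \<in> L i +> ?x i) \<and> (\<forall>i\<le>k. b i \<in> L i +> ?y i)}"
  have "\<forall>i\<le>k. ?x i \<in> L i +> ?x i" "\<forall>i\<le>k. ?y i \<in> L i +> ?y i"
    using self[OF F_carrier[OF xF]] self[OF F_carrier[OF yF]] by blast+
  then have "L k +> ?s ?x ?y \<in> ?S"
    by (intro CollectI exI[of _ ?x] exI[of _ ?y] conjI refl)
  moreover have "?S \<subseteq> {L k +> ?t}"
  proof (rule subsetI)
    fix z assume "z \<in> ?S"
    then obtain a b where z: "z = L k +> ?s a b"
      and ab: "\<forall>i\<le>k. a i \<in> L i +> ?x i" "\<forall>i\<le>k. b i \<in> L i +> ?y i"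
      by (elim CollectE exE conjE)
    show "z \<in> {L k +> ?t}" unfolding z coset[OF ab] by (rule singletonI)
  qed
  ultimately have S: "?S = {L k +> ?t}"
    by (rule singleton_of_subset)
  have "(graded_elem R F m x \<otimes>\<^bsub>assoc_graded R F\<^esub> graded_elem R F n y) k = \<Union>?S"
    by (simp only: assoc_graded_def monoid.select_convs graded_elem_apply)
  also have "\<dots> = graded_elem R F (m + n) (x \<otimes> y) k"
    unfolding S graded_elem_apply by (rule cSup_singleton)
  finally show "(graded_elem R F m x \<otimes>\<^bsub>assoc_graded R F\<^esub> graded_elem R F n y) k =
      graded_elem R F (m + n) (x \<otimes> y) k" .
qed

end

section \<open>The filtration\<close>

definition V_degree_le :: "nat \<Rightarrow> ('v::zero \<times> 'a, 'k::field) freealg \<Rightarrow> bool"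
  where "V_degree_le n p \<longleftrightarrow> (\<forall>w\<in>Poly_Mapping.keys p. length (filter (\<lambda>x. fst x \<noteq> 0) w) \<le> n)"

text \<open>The part below degree \<open>n\<close>, which is zero for \<open>n = 0\<close> in accordance with \<^const>\<open>filt_pred\<close>.\<close>

definition V_degree_less :: "nat \<Rightarrow> ('v::zero \<times> 'a, 'k::field) freealg \<Rightarrow> bool"
  where "V_degree_less n p \<longleftrightarrow> (case n of 0 \<Rightarrow> p = 0 | Suc m \<Rightarrow> V_degree_le m p)"

lemma V_degree_le_zero: "V_degree_le n 0"
  by (simp add: V_degree_le_def)

lemma V_degree_le_single:
  "length (filter (\<lambda>x. fst x \<noteq> 0) w) \<le> n \<Longrightarrow> V_degree_le n (Poly_Mapping.single w c)"
  by (simp add: V_degree_le_def)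

lemma V_degree_le_add: "V_degree_le n p \<Longrightarrow> V_degree_le n q \<Longrightarrow> V_degree_le n (p + q)"
  using keys_add[of p q] by (fastforce simp: V_degree_le_def)

lemma V_degree_le_mult: "V_degree_le m p \<Longrightarrow> V_degree_le n q \<Longrightarrow> V_degree_le (m + n) (p * q)"
  using keys_mult[of p q] unfolding V_degree_le_def plus_list_def
  by (fastforce intro: add_mono)

lemma V_degree_le_mono: "V_degree_le m p \<Longrightarrow> m \<le> n \<Longrightarrow> V_degree_le n p"
  by (fastforce simp: V_degree_le_def)

lemma V_degree_le_const: "V_degree_le n (const c)"
  unfolding const_def by (rule V_degree_le_single) simp

lemma V_degree_le_letter: "V_degree_le 1 (letter (v, a))" "V_degree_le 0 (letter (0, a))"
  unfolding letter_def by (rule V_degree_le_single; simp)+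

lemma homog_V_degree_le: "homog n p \<Longrightarrow> V_degree_le n p"
  by (induction rule: homog.induct)
     (auto intro: V_degree_le_zero V_degree_le_add V_degree_le_mult V_degree_le_const
        V_degree_le_letter(2) V_degree_le_letter(1)[unfolded One_nat_def])

lemma V_degree_less_add: "V_degree_less n p \<Longrightarrow> V_degree_less n q \<Longrightarrow> V_degree_less n (p + q)"
  by (auto simp: V_degree_less_def V_degree_le_add split: nat.splits)

lemma V_degree_less_diff: "V_degree_less n p \<Longrightarrow> V_degree_less n q \<Longrightarrow> V_degree_less n (p - q)"
proof -
  assume p: "V_degree_less n p" and q: "V_degree_less n q"
  have "V_degree_less n (const (- 1) * q)"
    using q V_degree_le_mult[OF V_degree_le_const, where m = 0]
    by (auto simp: V_degree_less_def split: nat.splits)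
  from V_degree_less_add[OF p this] show ?thesis by (simp add: const_simps)
qed

lemma V_degree_less_mult:
  "V_degree_less n p \<Longrightarrow> V_degree_le m q \<Longrightarrow> V_degree_less (m + n) (p * q)"
  "V_degree_less n p \<Longrightarrow> V_degree_le m q \<Longrightarrow> V_degree_less (m + n) (q * p)"
  using V_degree_le_mult[of _ p m q] V_degree_le_mult[of m q _ p]
  by (auto simp: V_degree_less_def V_degree_le_zero add.commute split: nat.splits)

lemma V_degree_less_imp_le: "V_degree_less n p \<Longrightarrow> V_degree_le n p"
  by (auto simp: V_degree_less_def V_degree_le_zero split: nat.splits intro: V_degree_le_mono)

context structure_relations
begin

abbreviation "I \<equiv> hideal sA \<Delta> sV act lam kap"
abbreviation "H \<equiv> halgebra sA \<Delta> sV act lam kap"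
abbreviation "cl \<equiv> hclass sA \<Delta> sV act lam kap"
abbreviation "F \<equiv> hfilt sA \<Delta> sV act lam kap"

lemma H_ring: "ring H"
  unfolding halgebra_def by (rule ideal.quotient_is_ring[OF ideal])

lemma cl_hom: "cl \<in> ring_hom ring_of_type_algebra H"
  using ideal.rcos_ring_hom[OF ideal] unfolding halgebra_def hclass_def by simp

lemma cl_simps:
  "cl p \<oplus>\<^bsub>H\<^esub> cl q = cl (p + q)" "cl p \<otimes>\<^bsub>H\<^esub> cl q = cl (p * q)" "\<one>\<^bsub>H\<^esub> = cl 1" "cl p \<in> carrier H"
  using ring_hom_add[OF cl_hom, of p q] ring_hom_mult[OF cl_hom, of p q] ring_hom_one[OF cl_hom]
    ring_hom_closed[OF cl_hom, of p]
  by simp_all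

lemma cl_eq_iff: "cl p = cl q \<longleftrightarrow> eqv p q"
proof -
  interpret R: ring "ring_of_type_algebra :: ('v \<times> 'a, 'k) freealg ring" by (rule ring_type_ring)
  show ?thesis
    using R.quotient_eq_iff_same_a_r_cos[OF ideal, of p q]
    unfolding hclass_def eqv_def by simp
qed

lemma cl_zero: "\<zero>\<^bsub>H\<^esub> = cl 0"
proof -
  interpret H: ring H by (rule H_ring)
  have "cl 0 \<oplus>\<^bsub>H\<^esub> cl 0 = cl 0" by (simp add: cl_simps(1))
  then show ?thesis
    using H.add.l_cancel_one'[of "cl 0" "cl 0"] cl_simps(4) by simp
qed

lemma carrier_H: "carrier H = range cl"
  unfolding halgebra_def hclass_def FactRing_def A_RCOSETS_def RCOSETS_def a_r_coset_def by auto

lemma hfilt_eq: "F n = {cl p | p. V_degree_le n p}"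
  unfolding hfilt_def V_degree_le_def ..

lemma hfilt_filtered_ring: "filtered_ring H F"
proof -
  interpret H: ring H by (rule H_ring)
  show ?thesis
  proof (rule filtered_ring.intro[OF H_ring filtered_ring_axioms.intro])
    fix n m x y
    have neg: "\<exists>q. V_degree_le n q \<and> \<ominus>\<^bsub>H\<^esub> cl p = cl q" if "V_degree_le n p" for p
    proof (intro exI conjI)
      show "V_degree_le n (const (- 1) * p)"
        using V_degree_le_mult[OF V_degree_le_const that, of 0] by simp
      show "\<ominus>\<^bsub>H\<^esub> cl p = cl (const (- 1) * p)"
        by (rule H.minus_equality) (simp_all add: cl_simps cl_zero const_simps)
    qed
    show "additive_subgroup (F n) H"
      unfolding hfilt_eq
    proof (rule additive_subgroupI, rule H.add.subgroupI)
      show "{cl p | p. V_degree_le n p} \<subseteq> carrier H" by (auto simp: cl_simps)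
      show "{cl p | p. V_degree_le n p} \<noteq> {}" using V_degree_le_zero by blast
      show "\<ominus>\<^bsub>H\<^esub> a \<in> {cl p | p. V_degree_le n p}" if "a \<in> {cl p | p. V_degree_le n p}" for a
        using that neg by blast
      show "a \<oplus>\<^bsub>H\<^esub> b \<in> {cl p | p. V_degree_le n p}"
        if a: "a \<in> {cl p | p. V_degree_le n p}" and b: "b \<in> {cl p | p. V_degree_le n p}" for a b
      proof -
        obtain p q where "V_degree_le n p" "a = cl p" "V_degree_le n q" "b = cl q" using a b by blast
        then show ?thesis using V_degree_le_add[of n p q] by (auto simp: cl_simps)
      qed
    qed
    show "F n \<subseteq> F (Suc n)"
      using V_degree_le_mono by (fastforce simp: hfilt_eq)
    show "x \<otimes>\<^bsub>H\<^esub> y \<in> F (m + n)" if x: "x \<in> F m" and y: "y \<in> F n"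
    proof -
      obtain p q where "V_degree_le m p" "x = cl p" "V_degree_le n q" "y = cl q"
        using x y unfolding hfilt_eq by blast
      then show ?thesis using V_degree_le_mult[of m p n q] by (auto simp: cl_simps hfilt_eq)
    qed
  qed
qed

sublocale filtered: filtered_ring H F
  by (rule hfilt_filtered_ring)

lemma cl_in_L: "V_degree_less n p \<Longrightarrow> cl p \<in> filt_pred H F n"
  by (auto simp: filt_pred_def hfilt_eq V_degree_less_def cl_zero split: nat.splits)

text \<open>Splitting every letter \<open>(v, a)\<close> into \<open>(v, 0) + (0, a)\<close> and expanding, the product of all the \<open>(v, 0)\<close> with
  \<open>v \<noteq> 0\<close> is the leading part, and every other term has lost a vector.\<close>

lemma word_leading_part:
  "\<exists>q r. homog (length (filter (\<lambda>x. fst x \<noteq> 0) w)) q \<and> V_degree_less (length (filter (\<lambda>x. fst x \<noteq> 0) w)) r \<and>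
    eqv (Poly_Mapping.single w c) (q + r)"
proof (induction w)
  case Nil
  have "homog 0 (const c) \<and> V_degree_less 0 0 \<and> eqv (Poly_Mapping.single [] c) (const c + 0)"
    by (simp add: homog_const V_degree_less_def single_Nil_eq_const)
  then show ?case by (metis filter.simps(1) list.size(3))
next
  case (Cons x w)
  obtain v a where x: "x = (v, a)" by (cases x)
  let ?d = "length (filter (\<lambda>x. fst x \<noteq> 0) w)"
  obtain q r where qr: "homog ?d q" "V_degree_less ?d r" "eqv (Poly_Mapping.single w c) (q + r)"
    using Cons by blast
  show ?case
  proof (cases "v = 0")
    case True
    have "eqv (Poly_Mapping.single (x # w) c) (letter (0, a) * (q + r))"
      unfolding single_Cons_eq_letter x True by (intro eqv_mult qr eqv_refl)
    then have "homog ?d (letter (0, a) * q) \<and> V_degree_less ?d (letter (0, a) * r) \<and>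
        eqv (Poly_Mapping.single (x # w) c) (letter (0, a) * q + letter (0, a) * r)"
      using homog_mult[OF homog_A qr(1)] V_degree_less_mult(2)[OF qr(2) V_degree_le_letter(2)]
      by (simp add: distrib_left)
    then show ?thesis using x True by auto
  next
    case False
    let ?r = "letter (v, 0) * r + letter (0, a) * (q + r)"
    have "eqv (Poly_Mapping.single (x # w) c) ((letter (v, 0) + letter (0, a)) * (q + r))"
      unfolding single_Cons_eq_letter x by (intro eqv_mult qr letter_split)
    then have "eqv (Poly_Mapping.single (x # w) c) (letter (v, 0) * q + ?r)"
      by (simp add: distrib_left distrib_right add_ac)
    moreover have "homog (Suc ?d) (letter (v, 0) * q)"
      using homog_mult[OF homog_V qr(1)] by simp
    moreover have "V_degree_less (Suc ?d) ?r"
    proof (rule V_degree_less_add)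
      show "V_degree_less (Suc ?d) (letter (v, 0) * r)"
        using V_degree_less_mult(2)[OF qr(2) V_degree_le_letter(1)] by simp
      have "V_degree_le ?d (q + r)"
        by (intro V_degree_le_add homog_V_degree_le V_degree_less_imp_le qr)
      then show "V_degree_less (Suc ?d) (letter (0, a) * (q + r))"
        using V_degree_le_mult[OF V_degree_le_letter(2)] by (fastforce simp: V_degree_less_def)
    qed
    ultimately show ?thesis using x False by auto
  qed
qed

lemma leading_part:
  assumes "V_degree_le n p"
  shows "\<exists>q r. homog n q \<and> V_degree_less n r \<and> eqv p (q + r)"
proof -
  have "\<exists>q r. homog n q \<and> V_degree_less n r \<and> eqv (\<Sum>w\<in>K. Poly_Mapping.single w (Poly_Mapping.lookup p w)) (q + r)"
    if "finite K" "K \<subseteq> Poly_Mapping.keys p" for K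
    using that
  proof (induction K)
    case empty
    have "homog n 0 \<and> V_degree_less n 0 \<and> eqv 0 (0 + 0)"
      by (auto simp: V_degree_less_def V_degree_le_zero intro: homog_zero split: nat.splits)
    then show ?case by (metis sum.empty)
  next
    case (insert w K)
    let ?d = "length (filter (\<lambda>x. fst x \<noteq> 0) w)" and ?s = "Poly_Mapping.single w (Poly_Mapping.lookup p w)"
    have d: "?d \<le> n" using assms insert.prems by (simp add: V_degree_le_def)
    have "\<exists>q r. homog n q \<and> V_degree_less n r \<and> eqv ?s (q + r)"
    proof (cases "?d = n")
      case True
      then show ?thesis using word_leading_part[of w] by blast
    next
      case False
      then have "V_degree_less n ?s"
        using d by (cases n) (auto simp: V_degree_less_def intro: V_degree_le_single)
      then have "homog n 0 \<and> V_degree_less n ?s \<and> eqv ?s (0 + ?s)" by (simp add: homog_zero)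
      then show ?thesis by blast
    qed
    then obtain q1 r1 where 1: "homog n q1" "V_degree_less n r1" "eqv ?s (q1 + r1)" by blast
    from insert obtain q2 r2 where 2: "homog n q2" "V_degree_less n r2"
      "eqv (\<Sum>w\<in>K. Poly_Mapping.single w (Poly_Mapping.lookup p w)) (q2 + r2)" by auto
    have "eqv (\<Sum>w\<in>insert w K. Poly_Mapping.single w (Poly_Mapping.lookup p w)) ((q1 + q2) + (r1 + r2))"
      using eqv_add[OF 1(3) 2(3)] insert.hyps by (simp add: algebra_simps)
    then show ?case
      using homog_add[OF 1(1) 2(1)] V_degree_less_add[OF 1(2) 2(2)] by blast
  qed
  from this[of "Poly_Mapping.keys p"] show ?thesis by (simp add: sum_singles)
qed

end

section \<open>From the associated graded algebra back to the deformation\<close>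

locale pbw_deformation = structure_relations sA sV \<Delta> act lam kap
  for sA :: "'k::field \<Rightarrow> 'a::ring_1 \<Rightarrow> 'a"
    and sV :: "'k \<Rightarrow> 'v::ab_group_add \<Rightarrow> 'v"
    and \<Delta> act lam kap +
  assumes PBW: "PBW_property sA \<Delta> sV act lam kap"
begin

sublocale Z: structure_relations sA sV \<Delta> act "\<lambda>_ _. 0" "\<lambda>_ _. 0"
  by unfold_locales

text \<open>The PBW property in terms of representatives: a homogeneous element vanishes in the
  smash product exactly if its class in the deformed algebra drops in the filtration. On a homogeneous
  element the PBW isomorphism takes the class in degree \<open>n\<close> of that same element, as it does so on
  generators.\<close>

lemma homog_mem_iff:
  assumes "homog n p"
  shows "p \<in> Z.I \<longleftrightarrow> cl p \<in> filt_pred H F n"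
proof -
  let ?G = "assoc_graded H F"
  interpret ZH: ring Z.H by (rule Z.H_ring)
  obtain \<phi> where \<phi>: "\<phi> \<in> ring_iso Z.H ?G"
    and \<phi>V: "\<And>v. \<phi> (Z.cl (letter (v, 0))) = graded_elem H F 1 (cl (letter (v, 0)))"
    and \<phi>A: "\<And>a. \<phi> (Z.cl (letter (0, a))) = graded_elem H F 0 (cl (letter (0, a)))"
    using PBW unfolding PBW_property_def Let_def by blast
  have hom: "\<phi> \<in> ring_hom Z.H ?G" and inj: "inj_on \<phi> (carrier Z.H)"
    using \<phi> by (auto simp: ring_iso_def bij_betw_def)
  have zero: "graded_elem H F n (cl 0) = \<zero>\<^bsub>?G\<^esub>" for n
    using filtered.graded_elem_eq_zero_iff[of "cl 0" n] filtered.L_zero[of n] by (simp add: cl_simps cl_zero)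
  \<comment> \<open>a ring homomorphism into a structure not yet known to be a ring might move zero, so its value
    there is read off from the letter \<open>(0, 0)\<close>\<close>
  have \<phi>0: "\<phi> (Z.cl 0) = \<zero>\<^bsub>?G\<^esub>"
  proof -
    have "Z.cl 0 = Z.cl (letter (0, 0))" "cl (letter (0, 0)) = cl 0"
      by (simp_all add: Z.cl_eq_iff cl_eq_iff Z.eqv_sym Z.letter_zero letter_zero)
    then show ?thesis using \<phi>A[of 0] zero[of 0] by simp
  qed
  have "\<phi> (Z.cl p) = graded_elem H F n (cl p)"
    using assms
  proof (induction rule: homog.induct)
    case (homog_zero n)
    then show ?case by (simp add: \<phi>0 zero)
  next
    case (homog_const c)
    have "Z.cl (const c) = Z.cl (letter (0, sA c 1))" "cl (const c) = cl (letter (0, sA c 1))"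
      by (simp_all add: Z.cl_eq_iff cl_eq_iff Z.const_eqv_letter const_eqv_letter)
    then show ?case by (simp add: \<phi>A)
  next
    case (homog_add n p q)
    then show ?case
      using ring_hom_add[OF hom Z.cl_simps(4) Z.cl_simps(4), of p q]
      by (simp add: Z.cl_simps(1) cl_simps(1,4) filtered.graded_elem_add)
  next
    case (homog_mult m p n q)
    have "cl p \<in> F m" "cl q \<in> F n"
      using homog_V_degree_le[OF homog_mult.hyps(1)] homog_V_degree_le[OF homog_mult.hyps(2)]
      by (auto simp: hfilt_eq)
    then show ?case
      using homog_mult.IH ring_hom_mult[OF hom Z.cl_simps(4) Z.cl_simps(4), of p q]
      by (simp add: Z.cl_simps(2) cl_simps(2) filtered.graded_elem_mult)
  qed (simp_all only: \<phi>V \<phi>A)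
  moreover have "p \<in> Z.I \<longleftrightarrow> \<phi> (Z.cl p) = \<phi> (Z.cl 0)"
    unfolding inj_on_eq_iff[OF inj Z.cl_simps(4) Z.cl_simps(4)] Z.cl_eq_iff Z.mem_iff_eqv_zero ..
  ultimately show ?thesis
    by (simp add: \<phi>0 filtered.graded_elem_eq_zero_iff cl_simps(4))
qed

text \<open>The commutator of \<open>q\<close> with a pure letter is homogeneous and, in the deformed algebra, equals up to
  sign the commutator of the lower part \<open>r\<close>, so its class drops in the filtration. Hence it is zero in the smash product.\<close>

lemma leading_part_commutes:
  assumes q: "homog n q" and r: "V_degree_less n r"
    and central: "\<And>x. eqv (letter x * (q + r)) ((q + r) * letter x)"
  shows "letter x * q - q * letter x \<in> Z.I"
proof -
  have homogeneous: "letter y * q - q * letter y \<in> Z.I" if y: "homog d (letter y :: ('v \<times> 'a, 'k) freealg)" for y d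
  proof -
    have deg: "V_degree_less (d + n) (r * letter y - letter y * r)"
      by (rule V_degree_less_diff[OF V_degree_less_mult(1)[OF r homog_V_degree_le[OF y]]
            V_degree_less_mult(2)[OF r homog_V_degree_le[OF y]]])
    have "(letter y * q - q * letter y) - (r * letter y - letter y * r) =
        letter y * (q + r) - (q + r) * letter y"
      by (simp add: algebra_simps)
    then have "eqv (letter y * q - q * letter y) (r * letter y - letter y * r)"
      using central[of y] by (simp add: eqv_def)
    then have "cl (letter y * q - q * letter y) \<in> filt_pred H F (d + n)"
      using cl_in_L[OF deg] by (simp add: cl_eq_iff[symmetric])
    moreover have "homog (d + n) (letter y * q - q * letter y)"
      using homog_mult[OF y q] homog_mult[OF q y] by (intro homog_diff) (simp_all add: add.commute)
    ultimately show ?thesis by (simp add: homog_mem_iff)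
  qed
  obtain v a where x: "x = (v, a)" by (cases x)
  let ?s = "letter (v, 0) + letter (0, a)"
  have "?s * q - q * ?s = (letter (v, 0) * q - q * letter (v, 0)) + (letter (0, a) * q - q * letter (0, a))"
    by (simp add: algebra_simps)
  then have "?s * q - q * ?s \<in> Z.I"
    using Z.add_mem[OF homogeneous[OF homog_V] homogeneous[OF homog_A]] by simp
  moreover have "Z.eqv (letter x * q - q * letter x) (?s * q - q * ?s)"
    unfolding x by (intro Z.eqv_diff Z.eqv_mult Z.letter_split Z.eqv_refl)
  ultimately show ?thesis by (simp add: Z.eqv_mem_iff)
qed

lemma center_eq_scalars:
  assumes graded_center: "\<And>n p. homog n p \<Longrightarrow> (\<And>x. letter x * p - p * letter x \<in> Z.I) \<Longrightarrow>
    (\<exists>c. p - const c \<in> Z.I) \<and> (n > 0 \<longrightarrow> p \<in> Z.I)"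
  shows "HH0 H = range (\<lambda>c. cl (const c))"
proof
  show "range (\<lambda>c. cl (const c)) \<subseteq> HH0 H"
    by (auto simp: HH0_def carrier_H cl_simps const_central)
  have scalar: "\<exists>c. eqv p (const c)"
    if "V_degree_le n p" "\<And>x. eqv (letter x * p) (p * letter x)" for n p
    using that
  proof (induction n arbitrary: p)
    case (0 p)
    obtain q r where qr: "homog 0 q" "V_degree_less 0 r" "eqv p (q + r)"
      using leading_part[OF 0(1)] by blast
    have pq: "eqv p q" using qr by (simp add: V_degree_less_def)
    have "eqv (letter x * q) (q * letter x)" for x
      by (meson "0.prems"(2) eqv_mult eqv_refl eqv_sym eqv_trans pq)
    then have "letter x * q - q * letter x \<in> Z.I" for x
      using qr by (intro leading_part_commutes[OF qr(1,2)]) (simp add: V_degree_less_def)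
    then obtain c where "q - const c \<in> Z.I"
      using graded_center[OF qr(1)] by blast
    then have "cl (q - const c) = cl 0"
      using homog_mem_iff[OF homog_diff[OF qr(1) homog_const]] by (simp add: filt_pred_def cl_zero)
    then have "eqv q (const c)" by (simp add: cl_eq_iff eqv_def)
    then show ?case using eqv_trans[OF pq] by blast
  next
    case (Suc n p)
    obtain q r where qr: "homog (Suc n) q" "V_degree_less (Suc n) r" "eqv p (q + r)"
      using leading_part[OF Suc.prems(1)] by blast
    have "eqv (letter x * (q + r)) ((q + r) * letter x)" for x
      by (meson Suc.prems(2) eqv_mult eqv_refl eqv_sym eqv_trans qr(3))
    then have "letter x * q - q * letter x \<in> Z.I" for x
      by (rule leading_part_commutes[OF qr(1,2)])
    then have "q \<in> Z.I" using graded_center[OF qr(1)] by blast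
    then have "cl q \<in> F n" using homog_mem_iff[OF qr(1)] by (simp add: filt_pred_def)
    then obtain q' where q': "V_degree_le n q'" "eqv q q'" by (auto simp: hfilt_eq cl_eq_iff)
    have p: "eqv p (q' + r)"
      using eqv_trans[OF qr(3) eqv_add[OF q'(2) eqv_refl]] .
    have "eqv (letter x * (q' + r)) ((q' + r) * letter x)" for x
      by (meson Suc.prems(2) eqv_mult eqv_refl eqv_sym eqv_trans p)
    moreover have "V_degree_le n (q' + r)"
      using q'(1) qr(2) by (simp add: V_degree_less_def V_degree_le_add)
    ultimately obtain c where "eqv (q' + r) (const c)"
      using Suc.IH by blast
    then show ?case using eqv_trans[OF p] by blast
  qed
  show "HH0 H \<subseteq> range (\<lambda>c. cl (const c))"
  proof
    fix z assume z: "z \<in> HH0 H"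
    then obtain p where p: "z = cl p" by (auto simp: HH0_def carrier_H)
    have "eqv (letter x * p) (p * letter x)" for x
      using z p by (auto simp: HH0_def carrier_H cl_simps cl_eq_iff intro: eqv_sym)
    moreover have "V_degree_le (\<Sum>w\<in>Poly_Mapping.keys p. length (filter (\<lambda>x. fst x \<noteq> 0) w)) p"
      unfolding V_degree_le_def by (auto intro: member_le_sum)
    ultimately obtain c where "eqv p (const c)" using scalar by blast
    then show "z \<in> range (\<lambda>c. cl (const c))" by (auto simp: p cl_eq_iff)
  qed
qed

end

section \<open>The center of the deformation\<close>

text \<open>Go one step back from the least length at which all products satisfy \<open>P\<close>. For \<open>P a\<close> being \<open>a = 0\<close> this is a longest
  nonzero product; for \<open>P a\<close> saying that \<open>a\<close> acts as zero on \<open>V\<close> it leads to a vector killed by \<open>U\<close>.\<close>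

lemma least_product_length:
  fixes P :: "'r::monoid_mult \<Rightarrow> bool"
  assumes "\<exists>n. \<forall>xs. length xs = n \<and> set xs \<subseteq> U \<longrightarrow> P (prod_list xs)" and "\<not> P 1"
  shows "\<exists>xs. set xs \<subseteq> U \<and> \<not> P (prod_list xs) \<and>
    (\<forall>ys. length ys = Suc (length xs) \<longrightarrow> set ys \<subseteq> U \<longrightarrow> P (prod_list ys))"
proof -
  let ?Q = "\<lambda>n. \<forall>xs. length xs = n \<and> set xs \<subseteq> U \<longrightarrow> P (prod_list xs)"
  define n where "n = (LEAST n. ?Q n)"
  have n: "?Q n" unfolding n_def using assms(1) by (rule LeastI_ex)
  have "n \<noteq> 0"
  proof
    assume "n = 0"
    then show False using n assms(2) by simp
  qed
  then obtain m where m: "n = Suc m" by (cases n) auto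
  then have "\<not> ?Q m" using not_less_Least[of m ?Q] by (simp add: n_def)
  then show ?thesis using n m by blast
qed

theorem theorem6p7:
  fixes sA :: "'k::field \<Rightarrow> 'a::ring_1 \<Rightarrow> 'a"
    and \<Delta> :: "'a \<Rightarrow> ('a \<times> 'a \<Rightarrow>\<^sub>0 'k)"
    and \<mm> :: "'a set"
    and sV :: "'k \<Rightarrow> 'v::ab_group_add \<Rightarrow> 'v"
    and act :: "'a \<Rightarrow> 'v \<Rightarrow> 'v"
    and lam :: "'a \<Rightarrow> 'v \<Rightarrow> 'a"
    and kap :: "'v \<Rightarrow> 'v \<Rightarrow> 'v \<times> 'a"
  assumes A: "cocommutative_algebra sA \<Delta>"
    and maximal: "maximalideal \<mm> (ring_of_type_algebra :: 'a ring)"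
    and nilpotent: "nilpotent_ideal \<mm>"
    and nonzero: "\<mm> \<noteq> {0}"
    and decomp: "\<And>a. \<exists>x\<in>\<mm>. \<exists>c. a = x + sA c 1"
    and direct: "\<mm> \<inter> range (\<lambda>c. sA c 1) = {0}"
    and coproduct_\<mm>: "\<And>a. a \<in> \<mm> \<Longrightarrow> in_tensor_square sA \<mm> (\<Delta> a)"
    and V: "vector_space sV" "algebra_module sA sV act"
    and V_nonzero: "\<exists>v::'v. v \<noteq> 0"
    and lam: "bilinear_map sA sV sA lam"
    and kap: "bilinear_map sV sV (module_prod.scale sV sA) kap" "\<And>v. kap v v = 0"
    and PBW: "PBW_property sA \<Delta> sV act lam kap"
    and Prim: "Prim \<mm> = Prim_op \<mm>"
    and lam_\<mm>: "\<And>a v. a \<in> \<mm> \<Longrightarrow> lam a v \<in> \<mm>"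
  shows "HH0 (halgebra sA \<Delta> sV act lam kap)
       = range (\<lambda>c. hclass sA \<Delta> sV act lam kap (const c))"
proof -
  interpret A: cocommutative_algebra sA \<Delta> by (rule A)
  interpret V: vector_space sV by (rule V)
  interpret structure_relations sA sV \<Delta> act lam kap by unfold_locales
  interpret pbw_deformation sA sV \<Delta> act lam kap
    by (rule pbw_deformation.intro[OF structure_relations_axioms]) (unfold_locales, rule PBW)
  have ideal: "0 \<in> \<mm>" "\<And>r x. x \<in> \<mm> \<Longrightarrow> x * r \<in> \<mm>"
    using maximalideal.axioms(1)[OF maximal] by (auto simp: ideal_type_ring_iff)
  have act_zero: "act 0 v = 0" "act 1 v = v" "act (a * b) v = act a (act b v)" for a b v
    using V(2) by (auto simp: algebra_module_def bilinear_map_def Vector_Spaces.linear_iff)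
       (metis add_cancel_left_right)
  obtain n where n: "\<And>xs. length xs = n \<Longrightarrow> set xs \<subseteq> \<mm> \<Longrightarrow> prod_list xs = 0"
    using nilpotent by (auto simp: nilpotent_ideal_def)
  have "(1::'a) \<noteq> 0"
    using nonzero ideal(1) by (metis is_singletonI' is_singleton_the_elem mult_zero_left mult_1 singletonD empty_iff)
  then obtain xs where xs: "set xs \<subseteq> \<mm>" "prod_list xs \<noteq> 0"
    "\<And>ys. set ys \<subseteq> \<mm> \<Longrightarrow> length ys = Suc (length xs) \<Longrightarrow> prod_list ys = 0"
    using least_product_length[of \<mm> "\<lambda>a. a = 0"] n by metis
  have "xs \<noteq> []"
  proof
    assume "xs = []"
    then have "x = 0" if "x \<in> \<mm>" for x using xs(3)[of "[x]"] that by simp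
    then show False using nonzero ideal(1) by blast
  qed
  then have xs_mem: "prod_list xs \<in> \<mm>"
    using xs(1) ideal(2) by (cases xs) auto
  have "\<not> (\<forall>v. act 1 v = 0)" using V_nonzero act_zero(2) by metis
  then obtain ys where ys: "set ys \<subseteq> \<mm>" "\<not> (\<forall>v. act (prod_list ys) v = 0)"
    "\<And>zs. length zs = Suc (length ys) \<Longrightarrow> set zs \<subseteq> \<mm> \<Longrightarrow> \<forall>v. act (prod_list zs) v = 0"
    using least_product_length[of \<mm> "\<lambda>a. \<forall>v. act a v = 0"] n act_zero(1) by metis
  then obtain w where w: "act (prod_list ys) w \<noteq> 0" by blast
  define v0 where "v0 = act (prod_list ys) w"
  have v0: "v0 \<noteq> 0" "\<And>x. x \<in> \<mm> \<Longrightarrow> act x v0 = 0"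
    using w ys(3)[of "_ # ys"] ys(1) by (auto simp: v0_def simp flip: act_zero(3))
  \<comment> \<open>\<open>v0\<close> is made a variable of the polynomial model\<close>
  let ?B = "V.extend_basis {v0}"
  have ind: "V.independent {v0}" using v0(1) by simp
  interpret M: smash_model sA \<Delta> sV act ?B
    using V(2) V.independent_extend_basis[OF ind] V.span_extend_basis[OF ind] by unfold_locales auto
  have "v0 \<in> ?B" using V.extend_basis_superset[OF ind] by simp
  note graded_center = M.homog_central[OF this v0(2) decomp coproduct_\<mm> xs(1) \<open>xs \<noteq> []\<close> xs(2) xs_mem xs(3)]
  show ?thesis
    by (rule center_eq_scalars) (use graded_center in blast)
qed

end
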